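(* For $n\ge1$ and $l\in\{1,\dots,n\}$ let $X_{n,l}$ be the depth of the node containing $l$ in the random binary search tree built from a uniformly random permutation of $\{1,\dots,n\}$. Suppose that $(l_n)$ is a sequence of integers with $1\le l_n\le n$ such that $$\frac{l_n}{n}=t+O\Big(\frac{1}{\sqrt{\log n}}\Big)$$ for some $t\in(0,1)$. Let $$\nu_{n,t}:=\mathcal{L}\big((2\log n+2\gamma+\log(t(1-t))-2X)^+\big),$$ where $X$ is exponentially distributed with mean $1$. Then, as $n\to\infty$, $$d_W\big(\mathcal{L}(X_{n,l_n}),\ \mathrm{MixPo}(\nu_{n,t})\big)=O\Big(\frac{1}{\sqrt{\log n}}\Big).$$
   Context: Random binary search tree: given a permutation $(\pi(1),\dots,\pi(n))$ of $\{1,\dots,n\}$, the keys are inserted in order $\pi(1),\pi(2),\dots$; $\pi(1)$ is the root, and each subsequent key moves left if smaller and right if larger than the current node's key, starting at the root, until it reaches an empty position where it is placed. The permutation is uniform over all $n!$ permutations. The depth of a node is its number of edges from the root. $\gamma$ is Euler's constant, $x^+=\max\{x,0\}$, $\log$ is the natural logarithm, and $\mathcal{L}(\cdot)$ denotes distribution. For a probability measure $\nu$ on $[0,\infty)$, $\mathrm{MixPo}(\nu)$ is the mixed Poisson distribution with $\mathrm{MixPo}(\nu)(\{k\})=\int e^{-\lambda}\lambda^k/k!\,\nu(d\lambda)$, $k\in\mathbb{N}_0$. For probability distributions $\mu,\nu$ on $\mathbb{R}$ with finite mean, $d_W(\mu,\nu):=\sup\{|\int f\,d\mu-\int f\,d\nu|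 : f:\mathbb{R}\to\mathbb{R},\ \sup_{|x-y|\le1}|f(x)-f(y)|\le1\}$; for distributions on the nonnegative integers this equals $\sum_{k\ge0}|\mu([k,\infty))-\nu([k,\infty))|$. *)

theory Defs
  imports "HOL-Probability.Probability" "HOL-Library.Tree" "HOL-Combinatorics.Multiset_Permutations"
    "HOL-Library.Landau_Symbols"
begin

fun bst_insert :: "nat \<Rightarrow> nat tree \<Rightarrow> nat tree" where
  "bst_insert x Leaf = Node Leaf x Leaf"
| "bst_insert x (Node l a r) =
     (if x < a then Node (bst_insert x l) a r
      else if a < x then Node l a (bst_insert x r)
      else Node l a r)"

definition bst_of_list :: "nat list \<Rightarrow> nat tree" where
  "bst_of_list xs = fold bst_insert xs Leaf"

fun node_depth :: "nat \<Rightarrow> nat tree \<Rightarrow> nat" where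
  "node_depth x Leaf = 0"
| "node_depth x (Node l a r) =
     (if x = a then 0 else if x < a then Suc (node_depth x l) else Suc (node_depth x r))"

definition bst_depth_dist :: "nat \<Rightarrow> nat \<Rightarrow> nat pmf" where
  "bst_depth_dist n l =
     map_pmf (\<lambda>xs. node_depth l (bst_of_list xs)) (pmf_of_set (permutations_of_set {1..n}))"

definition Exp1 :: "real measure" where
  "Exp1 = density lborel (exponential_density 1)"

definition nu :: "nat \<Rightarrow> real \<Rightarrow> real measure" where
  "nu n t = distr Exp1 borel
     (\<lambda>x. max 0 (2 * ln (real n) + 2 * euler_mascheroni + ln (t * (1 - t)) - 2 * x))"

definition mixpo :: "real measure \<Rightarrow> nat \<Rightarrow> real" where
  "mixpo M k = (\<integral>x. exp (- x) * x ^ k / fact k \<partial>M)"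

text \<open>Wasserstein distance of two distributions on N_0, given by point masses:
  sum over k of |mu([k,oo)) - nu([k,oo))|.\<close>
definition dW_nat :: "(nat \<Rightarrow> real) \<Rightarrow> (nat \<Rightarrow> real) \<Rightarrow> real" where
  "dW_nat p q = (\<Sum>k. \<bar>(\<Sum>j. p (k + j)) - (\<Sum>j. q (k + j))\<bar>)"

end

theory Submission
  imports Defs "HOL-Real_Asymp.Real_Asymp"
begin

text \<open>A key is an ancestor of \<open>l\<close> iff it comes first among the keys between itself and \<open>l\<close>. Give the
  keys independent uniform insertion times and condition on the time \<open>u\<close> of \<open>l\<close>: the depth is then
  \<open>K + K'\<close>, where \<open>K\<close> and \<open>K'\<close> are independent numbers of records of random permutations of binomial
  lengths \<open>N \<sim> Bin(l - 1, u)\<close> and \<open>N' \<sim> Bin(n - l, u)\<close>. As a sum of independent Bernoulli variables with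
  parameters \<open>1/i\<close>, \<open>i \<le> N\<close>, the number \<open>K\<close> is within \<open>O(1 / sqrt (ln N))\<close> of a Poisson variable with
  parameter \<open>harm N\<close>: replace the summands one at a time, smallest parameter first, so that the variance of the
  Poisson part already present smooths the next replacement. Finally \<open>harm N\<close> is close to
  \<open>ln (l u) + \<gamma>\<close>, \<open>harm N'\<close> to \<open>ln ((n - l) u) + \<gamma>\<close>, and \<open>- ln u\<close> is exponentially distributed.\<close>

section \<open>Poisson approximation of the number of records\<close>

text \<open>No probability space carrying insertion times is built. The mixture over
  \<open>u\<close> is identified with the law of the depth analytically: both obey the recursion
  obtained by splitting the tree at its root, and for the mixture this recursion is an integrated
  linear differential equation in \<open>u\<close>.

  The obstacle is small \<open>u\<close>: few keys then precede \<open>l\<close>, and the Poisson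
  approximation degrades. The conditional error is kept below the rate times
  \<open>1 / sqrt u\<close>, which is integrable over \<open>u\<close> in (0,1). Hence the binomial
  estimates carry explicit constants and powers of \<open>u\<close> and hold for all
  \<open>u\<close> in (0,1]. They rest on two binomial quantities only, the variance and the mean of
  \<open>1 / (N + 1)\<close>; square roots are reduced to these by a weighted arithmetic-geometric
  mean inequality.

  All laws act as operators on test functions with a starting point \<open>x\<close>, so that
  convolution is composition and the derivative in a Poisson parameter is an increment in
  \<open>x\<close>.\<close>

definition po_weight :: "real \<Rightarrow> nat \<Rightarrow> real" where
  "po_weight lam k = exp (- lam) * lam ^ k / fact k"

text \<open>The Poisson semigroup acting on \<open>f\<close>. Keeping the starting point
  \<open>x\<close> lets it compose with \<open>recs\<close>.\<close>

definition pois :: "real \<Rightarrow> (nat \<Rightarrow> real) \<Rightarrow> nat \<Rightarrow> real" where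
  "pois lam f x = (\<Sum>k. po_weight lam k * f (x + k))"

text \<open>Test functions for the Wasserstein distance. Boundedness makes the series and integrals
  below converge, and bounded functions suffice to recover the distance.\<close>

definition bdd_lip1 :: "(nat \<Rightarrow> real) \<Rightarrow> bool" where
  "bdd_lip1 f \<longleftrightarrow> Bseq f \<and> (\<forall>k. \<bar>f (Suc k) - f k\<bar> \<le> 1)"

lemma po_weight_nonneg [simp]: "0 \<le> lam \<Longrightarrow> 0 \<le> po_weight lam k"
  by (simp add: po_weight_def)

lemma po_weight_sums: "po_weight lam sums 1"
proof -
  have "(\<lambda>k. exp (- lam) * (lam ^ k /\<^sub>R fact k)) sums (exp (- lam) * exp lam)"
    by (intro sums_mult exp_converges)
  thus ?thesis
    by (simp add: po_weight_def [abs_def] exp_minus field_simps)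
qed

lemma Bseq_abs_bound:
  fixes f :: "nat \<Rightarrow> real"
  assumes "Bseq f"
  obtains B where "B > 0" "\<And>k. \<bar>f k\<bar> \<le> B"
  using assms by (auto simp: Bseq_def)

lemma pois_coeff_summable:
  fixes f :: "nat \<Rightarrow> real"
  assumes "Bseq f"
  shows "summable (\<lambda>k. f (x + k) / fact k * lam ^ k)"
proof -
  obtain B where B: "B > 0" "\<And>k. \<bar>f k\<bar> \<le> B" by (rule Bseq_abs_bound [OF assms]) blast
  show ?thesis
  proof (rule summable_comparison_test')
    show "summable (\<lambda>k. B * (inverse (fact k) * \<bar>lam\<bar> ^ k))"
      by (intro summable_mult summable_exp)
    show "norm (f (x + k) / fact k * lam ^ k) \<le> B * (inverse (fact k) * \<bar>lam\<bar> ^ k)" for k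
      using mult_right_mono [OF B(2)[of "x + k"], of "\<bar>lam\<bar> ^ k / fact k"]
      by (simp add: abs_mult power_abs field_simps)
  qed
qed

lemma pois_altdef:
  assumes "Bseq f"
  shows "pois lam f x = exp (- lam) * (\<Sum>k. f (x + k) / fact k * lam ^ k)"
  unfolding pois_def po_weight_def
  by (subst suminf_mult [symmetric, OF pois_coeff_summable [OF assms]]) (simp add: field_simps)

lemma pois_summable:
  assumes "Bseq f"
  shows "summable (\<lambda>k. po_weight lam k * f (x + k))"
  using summable_mult [OF pois_coeff_summable [OF assms, of x lam], of "exp (- lam)"]
  by (simp add: po_weight_def field_simps)

lemma pois_zero [simp]: "pois 0 f x = f x"
proof -
  have "(\<lambda>k. po_weight 0 k * f (x + k)) sums (\<Sum>k\<in>{0}. po_weight 0 k * f (x + k))"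
    by (rule sums_finite) (auto simp: po_weight_def)
  thus ?thesis by (simp add: pois_def sums_iff po_weight_def)
qed

lemma pois_abs_le:
  assumes "0 \<le> lam" "\<And>k. \<bar>f k\<bar> \<le> B"
  shows "\<bar>pois lam f x\<bar> \<le> B"
proof -
  have bd: "norm (po_weight lam k * f (x + k)) \<le> po_weight lam k * B" for k
    using assms by (auto simp: abs_mult intro!: mult_left_mono)
  have s: "(\<lambda>k. po_weight lam k * B) sums (1 * B)"
    by (intro sums_mult2 po_weight_sums)
  have "norm (pois lam f x) \<le> (\<Sum>k. po_weight lam k * B)"
    unfolding pois_def using bd sums_summable [OF s]
    by (intro norm_suminf_le) auto
  thus ?thesis using s by (simp add: sums_iff)
qed

lemma pois_diff:
  assumes "Bseq f" "Bseq g"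
  shows "pois lam (\<lambda>k. f k - g k) x = pois lam f x - pois lam g x"
  unfolding pois_def
  by (subst suminf_diff [OF pois_summable pois_summable]) (auto simp: assms algebra_simps)

lemma pois_shift: "pois lam (\<lambda>k. f (Suc k)) x = pois lam f (Suc x)"
  by (simp add: pois_def)

lemma Bseq_Suc: "Bseq (f :: nat \<Rightarrow> real) \<Longrightarrow> Bseq (\<lambda>k. f (Suc k))"
  by (auto simp: Bseq_def)

lemma pois_increment:
  assumes "Bseq f"
  shows "pois lam (\<lambda>k. f (Suc k) - f k) x = pois lam f (Suc x) - pois lam f x"
  by (simp add: pois_diff Bseq_Suc assms pois_shift)

text \<open>The generator of the semigroup: \<open>pois\<close> is \<open>exp (- lam)\<close> times
  a power series, and \<open>diffs\<close> turns the coefficient \<open>f (x + k) / fact k\<close>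
  into \<open>f (Suc x + k) / fact k\<close>.\<close>

lemma pois_has_derivative:
  assumes "Bseq f"
  shows "((\<lambda>lam. pois lam f x) has_real_derivative pois lam f (Suc x) - pois lam f x) (at lam)"
proof -
  define c where "c k = f (x + k) / fact k" for k
  have "((\<lambda>lam. exp (- lam) * (\<Sum>k. c k * lam ^ k)) has_real_derivative
      exp (- lam) * (\<Sum>k. diffs c k * lam ^ k) + - exp (- lam) * (\<Sum>k. c k * lam ^ k)) (at lam)"
    by (rule derivative_eq_intros termdiffs_strong_converges_everywhere refl
        pois_coeff_summable [OF assms, of x, folded c_def] | simp)+
  moreover have "diffs c k = f (Suc x + k) / fact k" for k
    by (simp add: diffs_def c_def divide_simps)
  ultimately show ?thesis
    by (simp add: pois_altdef [OF assms] c_def)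
qed

text \<open>Stein's identity for the Poisson law, from
  \<open>k * po_weight lam k = lam * po_weight lam (k - 1)\<close> for \<open>k > 0\<close>; the
  term at 0 vanishes.\<close>

lemma pois_moment_shift:
  assumes "(\<lambda>k. po_weight lam k * g (Suc k)) sums s"
  shows "(\<lambda>k. real k * po_weight lam k * g k) sums (lam * s)"
proof -
  have "(\<lambda>k. lam * (po_weight lam k * g (Suc k))) sums (lam * s)"
    by (intro sums_mult assms)
  moreover have "lam * (po_weight lam k * g (Suc k)) = real (Suc k) * po_weight lam (Suc k) * g (Suc k)" for k
    by (simp add: po_weight_def divide_simps del: of_nat_Suc)
  ultimately have "(\<lambda>k. real (Suc k) * po_weight lam (Suc k) * g (Suc k)) sums (lam * s)"
    by (simp only:)
  thus ?thesis using sums_Suc_iff [of "\<lambda>k. real k * po_weight lam k * g k" "lam * s"] by simp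
qed

lemma po_weight_variance: "(\<lambda>k. po_weight lam k * (real k - lam)\<^sup>2) sums lam"
proof -
  have 1: "(\<lambda>k. real k * po_weight lam k * 1) sums (lam * 1)"
    by (rule pois_moment_shift) (use po_weight_sums [of lam] in simp)
  have "(\<lambda>k. po_weight lam k * real (Suc k)) sums (lam + 1)"
    using sums_add [OF 1 po_weight_sums [of lam]] by (simp add: algebra_simps)
  hence 2: "(\<lambda>k. real k * po_weight lam k * real k) sums (lam * (lam + 1))"
    by (rule pois_moment_shift)
  have "(\<lambda>k. real k * po_weight lam k * real k - 2 * lam * (real k * po_weight lam k * 1)
      + lam\<^sup>2 * po_weight lam k) sums (lam * (lam + 1) - 2 * lam * (lam * 1) + lam\<^sup>2 * 1)"
    by (intro sums_add sums_diff sums_mult 1 2 po_weight_sums)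
  thus ?thesis by (simp add: power2_eq_square algebra_simps)
qed

text \<open>Stands in for the Cauchy-Schwarz inequality: the right side is linear in the square, so
  means can be taken term by term and the weight \<open>e\<close> chosen to balance them.\<close>

lemma abs_le_weighted_square:
  fixes a e :: real
  assumes "e > 0"
  shows "\<bar>a\<bar> \<le> (e * a\<^sup>2 + 1 / e) / 2"
proof -
  have "0 \<le> (sqrt e * \<bar>a\<bar> - 1 / sqrt e)\<^sup>2" by simp
  also have "\<dots> = e * a\<^sup>2 + 1 / e - 2 * \<bar>a\<bar>"
    using assms by (simp add: power2_eq_square algebra_simps)
  finally show ?thesis by simp
qed

text \<open>By Stein's identity, \<open>lam\<close> times the increment is the mean of
  \<open>(K - lam) * g (x + K)\<close> for a Poisson variable \<open>K\<close>, whose mean absolute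
  deviation is at most \<open>sqrt lam\<close>. The smoothing comes from the Poisson law, as
  \<open>g\<close> is merely bounded.\<close>

lemma pois_increment_bound:
  assumes "lam > 0" "\<And>k. \<bar>g k\<bar> \<le> 1"
  shows "\<bar>pois lam g (Suc x) - pois lam g x\<bar> \<le> 1 / sqrt lam"
proof -
  have Bg: "Bseq g" using assms(2) by (intro BseqI' [of _ 1]) simp
  have s0: "(\<lambda>k. po_weight lam k * g (x + k)) sums pois lam g x"
    unfolding pois_def by (intro summable_sums pois_summable Bg)
  have s1: "(\<lambda>k. po_weight lam k * g (x + Suc k)) sums pois lam g (Suc x)"
    using summable_sums [OF pois_summable [OF Bg, of lam "Suc x"]] by (simp add: pois_def)
  have s: "(\<lambda>k. po_weight lam k * (real k - lam) * g (x + k)) sums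
      (lam * (pois lam g (Suc x) - pois lam g x))"
    using sums_diff [OF pois_moment_shift [OF s1] sums_mult [OF s0, of lam]]
    by (simp add: algebra_simps)
  have b: "(\<lambda>k. (1 / sqrt lam * (po_weight lam k * (real k - lam)\<^sup>2) + sqrt lam * po_weight lam k) / 2)
      sums ((1 / sqrt lam * lam + sqrt lam * 1) / 2)"
    by (intro sums_divide sums_add sums_mult po_weight_variance po_weight_sums)
  have le: "norm (po_weight lam k * (real k - lam) * g (x + k)) \<le>
      (1 / sqrt lam * (po_weight lam k * (real k - lam)\<^sup>2) + sqrt lam * po_weight lam k) / 2" for k
  proof -
    have "norm (po_weight lam k * (real k - lam) * g (x + k)) \<le> po_weight lam k * \<bar>real k - lam\<bar> * 1"
      unfolding real_norm_def abs_mult using assms by (intro mult_mono) auto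
    also have "\<dots> \<le> po_weight lam k * ((1 / sqrt lam * (real k - lam)\<^sup>2 + 1 / (1 / sqrt lam)) / 2)"
      unfolding mult_1_right
      using assms by (intro mult_left_mono abs_le_weighted_square) auto
    finally show ?thesis by (simp add: field_simps)
  qed
  have "norm (lam * (pois lam g (Suc x) - pois lam g x)) \<le> (1 / sqrt lam * lam + sqrt lam * 1) / 2"
    using norm_suminf_le [of _ _, OF le sums_summable [OF b]] s b by (simp add: sums_iff)
  also have "\<dots> = sqrt lam" using assms by (simp add: real_div_sqrt)
  finally have "lam * \<bar>pois lam g (Suc x) - pois lam g x\<bar> \<le> sqrt lam"
    using assms by (simp add: abs_mult)
  hence "\<bar>pois lam g (Suc x) - pois lam g x\<bar> \<le> sqrt lam / lam"
    using assms by (simp add: pos_le_divide_eq mult.commute)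
  also have "sqrt lam / lam = sqrt lam / (sqrt lam * sqrt lam)" using assms by simp
  also have "\<dots> = 1 / sqrt lam" using assms by (simp del: real_sqrt_mult_self)
  finally show ?thesis .
qed

text \<open>The trivial bound 2 combined with the smoothing bound. The case
  \<open>lam \<le> 0\<close> is separate because \<open>1 / sqrt 0\<close> is 0 and would spoil the
  minimum; the value at 0 does occur, in the replacement of the smallest Bernoulli
  parameter.\<close>

definition stein_bound :: "real \<Rightarrow> real" where
  "stein_bound lam = (if lam \<le> 0 then 2 else min 2 (1 / sqrt lam))"

lemma stein_bound_nonneg: "0 \<le> stein_bound lam"
  by (simp add: stein_bound_def)

lemma stein_bound_antimono: "lam \<le> mu \<Longrightarrow> stein_bound mu \<le> stein_bound lam"
proof (cases "lam \<le> 0")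
  case False
  assume "lam \<le> mu"
  with False have "1 / sqrt mu \<le> 1 / sqrt lam" by (intro divide_left_mono) auto
  with False \<open>lam \<le> mu\<close> show ?thesis by (simp add: stein_bound_def)
qed (simp add: stein_bound_def)

lemma pois_second_increment_bound:
  assumes "0 \<le> lam" "\<And>k. \<bar>g k\<bar> \<le> 1"
  shows "\<bar>pois lam g (Suc x) - pois lam g x\<bar> \<le> stein_bound lam"
proof -
  have "\<bar>pois lam g (Suc x)\<bar> \<le> 1" "\<bar>pois lam g x\<bar> \<le> 1"
    using assms by (intro pois_abs_le; simp)+
  hence "\<bar>pois lam g (Suc x) - pois lam g x\<bar> \<le> 2" by linarith
  thus ?thesis using pois_increment_bound [of lam g x] assms
    unfolding stein_bound_def by (cases "lam \<le> 0") auto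
qed

lemma pois_lipschitz_mono:
  assumes "0 \<le> lam" "lam \<le> mu" "bdd_lip1 f"
  shows "\<bar>pois mu f x - pois lam f x\<bar> \<le> mu - lam"
proof (cases "lam = mu")
  case False
  hence "lam < mu" using assms by simp
  then obtain z where z: "lam < z" "z < mu"
      "pois mu f x - pois lam f x = (mu - lam) * (pois z f (Suc x) - pois z f x)"
    using MVT2 [of lam mu "\<lambda>s. pois s f x" "\<lambda>z. pois z f (Suc x) - pois z f x"]
      pois_has_derivative assms(3) by (auto simp: bdd_lip1_def)
  have "\<bar>pois z (\<lambda>k. f (Suc k) - f k) x\<bar> \<le> 1"
    using assms z by (intro pois_abs_le) (auto simp: bdd_lip1_def)
  hence "\<bar>pois z f (Suc x) - pois z f x\<bar> \<le> 1"
    using assms by (simp add: pois_increment bdd_lip1_def)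
  hence "(mu - lam) * \<bar>pois z f (Suc x) - pois z f x\<bar> \<le> mu - lam"
    using \<open>lam < mu\<close> by (intro mult_left_le) auto
  thus ?thesis using z \<open>lam < mu\<close> by (simp add: abs_mult)
qed simp

lemma pois_lipschitz:
  assumes "0 \<le> lam" "0 \<le> mu" "bdd_lip1 f"
  shows "\<bar>pois mu f x - pois lam f x\<bar> \<le> \<bar>mu - lam\<bar>"
  using pois_lipschitz_mono [of lam mu f x] pois_lipschitz_mono [of mu lam f x] assms
  by (cases "lam \<le> mu") (auto simp: abs_minus_commute)

text \<open>The Bernoulli average is the linear Taylor polynomial of
  \<open>pois (lam + p) f x\<close> at \<open>lam\<close>. The second derivative is a second
  increment, controlled by \<open>stein_bound\<close>, and two mean value steps give the
  remainder.\<close>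

lemma pois_bernoulli_step:
  assumes "0 \<le> lam" "0 \<le> p" "bdd_lip1 f"
  shows "\<bar>((1 - p) * pois lam f x + p * pois lam f (Suc x)) - pois (lam + p) f x\<bar> \<le> p\<^sup>2 * stein_bound lam"
proof (cases "p = 0")
  case False
  hence p: "p > 0" using assms by simp
  have Bf: "Bseq f" using assms by (simp add: bdd_lip1_def)
  define g where "g k = f (Suc k) - f k" for k
  have g: "\<bar>g k\<bar> \<le> 1" for k using assms(3) by (simp add: bdd_lip1_def g_def)
  have Bg: "Bseq g" using g by (intro BseqI' [of _ 1]) simp
  have inc: "pois s f (Suc y) - pois s f y = pois s g y" for s y
    unfolding g_def by (simp add: pois_increment Bf)
  obtain z where z: "lam < z" "z < lam + p" "pois (lam + p) f x - pois lam f x = p * pois z g x"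
    using MVT2 [of lam "lam + p" "\<lambda>s. pois s f x" "\<lambda>z. pois z f (Suc x) - pois z f x"]
      pois_has_derivative [OF Bf] p by (auto simp: inc)
  obtain w where w: "lam < w" "w < z" "pois z g x - pois lam g x = (z - lam) * (pois w g (Suc x) - pois w g x)"
    using MVT2 [of lam z "\<lambda>s. pois s g x" "\<lambda>z. pois z g (Suc x) - pois z g x"]
      pois_has_derivative [OF Bg] z by auto
  have "\<bar>pois w g (Suc x) - pois w g x\<bar> \<le> stein_bound w"
    using w assms g by (intro pois_second_increment_bound) auto
  also have "\<dots> \<le> stein_bound lam" using w by (intro stein_bound_antimono) simp
  finally have "(z - lam) * \<bar>pois w g (Suc x) - pois w g x\<bar> \<le> p * stein_bound lam"
    using z by (intro mult_mono) auto
  hence *: "\<bar>pois z g x - pois lam g x\<bar> \<le> p * stein_bound lam"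
    using w z by (simp add: abs_mult)
  have "(1 - p) * pois lam f x + p * pois lam f (Suc x) - pois (lam + p) f x
      = - (p * (pois z g x - pois lam g x))"
    using z(3) inc[of lam x] by (simp add: algebra_simps)
  hence "\<bar>(1 - p) * pois lam f x + p * pois lam f (Suc x) - pois (lam + p) f x\<bar>
      = p * \<bar>pois z g x - pois lam g x\<bar>"
    using p by (simp only: abs_minus_cancel abs_mult abs_of_pos)
  also have "\<dots> \<le> p * (p * stein_bound lam)" using * p by (intro mult_left_mono) auto
  finally show ?thesis by (simp add: power2_eq_square mult.assoc)
qed simp

text \<open>\<open>recs i f x\<close> is the expectation of \<open>f (x + K)\<close> for the number \<open>K\<close> of records in
  a random permutation of length \<open>i\<close>, a sum of independent Bernoulli variables of
  parameters \<open>1, 1/2, \<dots>, 1/i\<close>.\<close>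

primrec recs :: "nat \<Rightarrow> (nat \<Rightarrow> real) \<Rightarrow> nat \<Rightarrow> real" where
  "recs 0 f = f"
| "recs (Suc i) f = (\<lambda>x. (real i * recs i f x + recs i f (Suc x)) / (real i + 1))"

lemma recs_shift: "recs i (\<lambda>x. f (Suc x)) = (\<lambda>x. recs i f (Suc x))"
  by (induction i) auto

lemma recs_linear: "recs i (\<lambda>x. a * f x + b * g x) = (\<lambda>x. a * recs i f x + b * recs i g x)"
proof (induction i)
  case (Suc i)
  have "real i + 1 \<noteq> 0" by linarith
  have "real i * (a * p + b * q) + (a * r + b * s) = a * (real i * p + r) + b * (real i * q + s)"
    for p q r s by (simp add: algebra_simps)
  thus ?case unfolding recs.simps Suc
    by (simp add: fun_eq_iff add_divide_distrib [symmetric] distrib_left)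
qed simp

lemma recs_diff: "recs i (\<lambda>x. f x - g x) x = recs i f x - recs i g x"
  using recs_linear [of i 1 f "-1" g] by (simp add: fun_eq_iff)

lemma recs_abs_le:
  assumes "\<And>x. \<bar>f x\<bar> \<le> B"
  shows "\<bar>recs i f x\<bar> \<le> B"
proof (induction i arbitrary: x)
  case (Suc i)
  have "\<bar>real i * recs i f x + recs i f (Suc x)\<bar> \<le> real i * \<bar>recs i f x\<bar> + \<bar>recs i f (Suc x)\<bar>"
    by (rule order_trans [OF abs_triangle_ineq]) (simp add: abs_mult)
  also have "\<dots> \<le> real i * B + B"
    by (intro add_mono mult_left_mono Suc.IH) auto
  finally show ?case by (simp add: field_simps)
qed (simp add: assms)

text \<open>The recursion adds the new Bernoulli variable outside. Moved inside, next to
  \<open>f\<close>, it puts both sides of a replacement under the same contraction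
  \<open>recs i\<close>.\<close>

lemma recs_Suc_inner:
  "recs (Suc i) f = recs i (\<lambda>x. (1 - 1 / (real i + 1)) * f x + 1 / (real i + 1) * f (Suc x))"
  unfolding recs_linear recs_shift by (simp add: fun_eq_iff divide_simps)

lemma recs_pois_telescope:
  assumes "bdd_lip1 f" "0 \<le> mu"
  shows "\<bar>recs i (pois mu f) x - pois (mu + harm i) f x\<bar>
    \<le> (\<Sum>k<i. (1 / (real k + 1))\<^sup>2 * stein_bound (harm i - harm (Suc k)))"
proof -
  \<comment> \<open>Hybrid law: the Bernoulli variables of parameters \<open>1, ..., 1 / k\<close>
    are kept and the others merged into the Poisson part. Between \<open>T (Suc k)\<close> and
    \<open>T k\<close> only the parameter \<open>1 / (k + 1)\<close> is exchanged.\<close>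
  define T where "T k = recs k (pois (mu + harm i - harm k) f) x" for k
  have step: "\<bar>T (Suc k) - T k\<bar> \<le> (1 / (real k + 1))\<^sup>2 * stein_bound (harm i - harm (Suc k))"
    if "k < i" for k
  proof -
    define lam where "lam = mu + harm i - harm (Suc k)"
    define p where "p = 1 / (real k + 1)"
    have le: "harm (Suc k) \<le> (harm i :: real)" using that by (intro harm_mono) simp
    have lam: "lam \<ge> 0" "harm i - harm (Suc k) \<le> lam" using le assms by (auto simp: lam_def)
    have "lam + p = mu + harm i - harm k"
      by (simp add: lam_def p_def harm_Suc field_simps)
    hence "T (Suc k) - T k
       = recs k (\<lambda>x. ((1 - p) * pois lam f x + p * pois lam f (Suc x)) - pois (lam + p) f x) x"
      unfolding T_def recs_diff recs_Suc_inner p_def [symmetric] lam_def [symmetric] by simp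
    also have "\<bar>\<dots>\<bar> \<le> p\<^sup>2 * stein_bound lam"
      using assms lam by (intro recs_abs_le pois_bernoulli_step) (auto simp: p_def)
    also have "\<dots> \<le> p\<^sup>2 * stein_bound (harm i - harm (Suc k))"
      by (intro mult_left_mono stein_bound_antimono lam) auto
    finally show ?thesis by (simp add: p_def)
  qed
  have "T i - T 0 = (\<Sum>k<i. T (Suc k) - T k)" by (rule sum_lessThan_telescope [symmetric])
  also have "\<bar>\<dots>\<bar> \<le> (\<Sum>k<i. (1 / (real k + 1))\<^sup>2 * stein_bound (harm i - harm (Suc k)))"
    by (rule order_trans [OF sum_abs]) (intro sum_mono step, simp)
  finally show ?thesis by (simp add: T_def harm_expand)
qed

lemma harm_diff_ge_ln:
  assumes "m \<le> n"
  shows "ln (real n + 1) - ln (real m + 1) \<le> harm n - harm m"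
  using assms
proof (induction n rule: dec_induct)
  case (step n)
  have "ln (real n + 1 + 1) - ln (real n + 1) \<le> 1 / (real n + 1)"
    using ln_diff_le_inverse [of "real n + 1"] by (simp add: add.commute)
  moreover have "harm (Suc n) = harm n + 1 / (real n + 1)"
    by (simp add: harm_Suc inverse_eq_divide add.commute)
  ultimately show ?case using step.IH by (simp add: algebra_simps)
qed simp

text \<open>With \<open>lam = harm i - harm (Suc k)\<close> one has
  \<open>ln (i + 1) \<le> lam + (k + 1)\<close> and
  \<open>stein_bound lam * sqrt lam \<le> 1\<close>. This extracts the rate for every
  \<open>k\<close>; the price \<open>sqrt (k + 1)\<close> is paid by the factor
  \<open>1 / (k + 1)^2\<close> of the replacement.\<close>

lemma stein_bound_harm:
  assumes "k < i"
  shows "stein_bound (harm i - harm (Suc k)) \<le> (1 + 2 * sqrt (real k + 1)) / sqrt (ln (real i + 1))"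
proof -
  define lam :: real where "lam = harm i - harm (Suc k)"
  have lam: "0 \<le> lam" using assms harm_mono [of "Suc k" i] by (simp add: lam_def)
  have pos: "ln (real i + 1) > 0" using assms by simp
  have "ln (real i + 1) \<le> lam + ln (real k + 2)"
    using harm_diff_ge_ln [of "Suc k" i] assms by (simp add: lam_def add.commute)
  also have "ln (real k + 2) \<le> real k + 1"
    using ln_le_minus_one [of "real k + 2"] by simp
  finally have "sqrt (ln (real i + 1)) \<le> sqrt (lam + (real k + 1))" by simp
  also have "\<dots> \<le> sqrt lam + sqrt (real k + 1)" using lam by (intro sqrt_add_le_add_sqrt) auto
  finally have "stein_bound lam * sqrt (ln (real i + 1)) \<le> stein_bound lam * sqrt lam + stein_bound lam * sqrt (real k + 1)"
    using mult_left_mono [OF _ stein_bound_nonneg] by (metis distrib_left)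
  also have "stein_bound lam * sqrt lam \<le> 1" using lam
    by (auto simp: stein_bound_def min_def field_simps)
  also have "stein_bound lam * sqrt (real k + 1) \<le> 2 * sqrt (real k + 1)"
    by (intro mult_right_mono) (auto simp: stein_bound_def)
  finally show ?thesis using pos unfolding lam_def [symmetric] by (simp add: field_simps)
qed

text \<open>The parameter \<open>mu\<close> makes room for the Poisson variable that has already
  replaced the records on the other side of the key. At \<open>i = 0\<close> the bound is 0 by the
  convention for division, rightly so as nothing is replaced.\<close>

lemma recs_pois_bound:
  obtains C where "C > 0" "\<And>f mu i x. bdd_lip1 f \<Longrightarrow> 0 \<le> mu \<Longrightarrow>
    \<bar>recs i (pois mu f) x - pois (mu + harm i) f x\<bar> \<le> C / sqrt (ln (real i + 1))"
proof -
  \<comment> \<open>With \<open>z = k + 1\<close>, the summand \<open>(1 + 2 * sqrt z) / z^2\<close>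
    is at most \<open>3 * z powr (-3/2)\<close>, which is summable.\<close>
  define a where "a k = 3 * (real k + 1) powr (-3/2)" for k
  have "summable (\<lambda>k. 3 * real k powr (-3/2))"
    by (intro summable_mult) (simp add: summable_real_powr_iff)
  hence sum_a: "summable a"
    unfolding a_def by (subst (asm) summable_Suc_iff [symmetric]) (simp add: add.commute)
  have a_pos: "a k > 0" for k by (simp add: a_def)
  have a_ge: "(1 / (real k + 1))\<^sup>2 * (1 + 2 * sqrt (real k + 1)) \<le> a k" for k
  proof -
    have "1 + 2 * sqrt (real k + 1) \<le> 3 * sqrt (real k + 1)" by simp
    hence "(1 / (real k + 1))\<^sup>2 * (1 + 2 * sqrt (real k + 1)) \<le> (1 / (real k + 1))\<^sup>2 * (3 * sqrt (real k + 1))"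
      by (intro mult_left_mono) auto
    also have "\<dots> = (real k + 1) powr (-2) * (3 * (real k + 1) powr (1/2))"
      by (simp add: powr_minus power_one_over powr_half_sqrt field_simps)
    also have "\<dots> = a k"
      unfolding a_def by (simp add: powr_add [symmetric])
    finally show ?thesis .
  qed
  show ?thesis
  proof
    show "(\<Sum>k. a k) > 0" using sum_a a_pos by (intro suminf_pos)
    fix f mu i x assume "bdd_lip1 f" "(0::real) \<le> mu"
    hence "\<bar>recs i (pois mu f) x - pois (mu + harm i) f x\<bar>
      \<le> (\<Sum>k<i. (1 / (real k + 1))\<^sup>2 * stein_bound (harm i - harm (Suc k)))"
      by (rule recs_pois_telescope)
    also have "\<dots> \<le> (\<Sum>k<i. a k / sqrt (ln (real i + 1)))"
    proof (intro sum_mono)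
      fix k assume "k \<in> {..<i}"
      hence "(1 / (real k + 1))\<^sup>2 * stein_bound (harm i - harm (Suc k))
        \<le> (1 / (real k + 1))\<^sup>2 * ((1 + 2 * sqrt (real k + 1)) / sqrt (ln (real i + 1)))"
        by (intro mult_left_mono stein_bound_harm) auto
      also have "\<dots> = ((1 / (real k + 1))\<^sup>2 * (1 + 2 * sqrt (real k + 1))) / sqrt (ln (real i + 1))"
        by simp
      also have "\<dots> \<le> a k / sqrt (ln (real i + 1))"
        by (intro divide_right_mono a_ge) auto
      finally show "(1 / (real k + 1))\<^sup>2 * stein_bound (harm i - harm (Suc k)) \<le> a k / sqrt (ln (real i + 1))" .
    qed
    also have "\<dots> = (\<Sum>k<i. a k) / sqrt (ln (real i + 1))" by (simp add: sum_divide_distrib)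
    also have "\<dots> \<le> (\<Sum>k. a k) / sqrt (ln (real i + 1))"
      using sum_a a_pos by (intro divide_right_mono sum_le_suminf) (auto intro: less_imp_le)
    finally show "\<bar>recs i (pois mu f) x - pois (mu + harm i) f x\<bar> \<le> (\<Sum>k. a k) / sqrt (ln (real i + 1))" .
  qed
qed

section \<open>Binomial mixtures\<close>

text \<open>\<open>bino u a c\<close> is the expectation of \<open>c\<close> under the binomial distribution with parameters \<open>a\<close> and \<open>u\<close>.\<close>

primrec bino :: "real \<Rightarrow> nat \<Rightarrow> (nat \<Rightarrow> real) \<Rightarrow> real" where
  "bino u 0 c = c 0"
| "bino u (Suc a) c = (1 - u) * bino u a c + u * bino u a (\<lambda>i. c (Suc i))"

lemma bino_linear: "bino u a (\<lambda>i. x * c i + y * d i) = x * bino u a c + y * bino u a d"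
  by (induction a arbitrary: c d) (auto simp: algebra_simps)

lemma bino_add: "bino u a (\<lambda>i. c i + d i) = bino u a c + bino u a d"
  using bino_linear [of u a 1 c 1 d] by simp

lemma bino_diff: "bino u a (\<lambda>i. c i - d i) = bino u a c - bino u a d"
  using bino_linear [of u a 1 c "-1" d] by simp

lemma bino_cmult: "bino u a (\<lambda>i. x * c i) = x * bino u a c"
  using bino_linear [of u a x c 0 c] by simp

lemma bino_const [simp]: "bino u a (\<lambda>i. x) = x"
  by (induction a) (auto simp: algebra_simps)

lemma bino_sum: "bino u a (\<lambda>i. \<Sum>k<n. c k i) = (\<Sum>k<n. bino u a (c k))"
  for n :: nat
  by (induction n) (auto simp: bino_add)

lemma bino_mono:
  assumes "0 \<le> u" "u \<le> 1" "\<And>i. c i \<le> d i"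
  shows "bino u a c \<le> bino u a d"
  using assms(3)
proof (induction a arbitrary: c d)
  case (Suc a)
  show ?case unfolding bino.simps
    using assms(1,2) by (intro add_mono mult_left_mono Suc.IH Suc.prems) auto
qed simp

lemma bino_abs_le:
  assumes "0 \<le> u" "u \<le> 1"
  shows "\<bar>bino u a c\<bar> \<le> bino u a (\<lambda>i. \<bar>c i\<bar>)"
  using bino_mono [OF assms, of c "\<lambda>i. \<bar>c i\<bar>" a] bino_mono [OF assms, of "\<lambda>i. - \<bar>c i\<bar>" c a]
    bino_cmult [of u a "-1" "\<lambda>i. \<bar>c i\<bar>"] by fastforce

text \<open>Size biasing: \<open>i * (a choose i) = a * (a - 1 choose i - 1)\<close>. At
  \<open>a = 0\<close> the truncated \<open>a - 1\<close> is harmless, since the factor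
  \<open>real a\<close> vanishes.\<close>

lemma bino_times_index:
  "bino u a (\<lambda>i. real i * c i) = real a * u * bino u (a - 1) (\<lambda>i. c (Suc i))"
proof (induction a arbitrary: c)
  case (Suc a)
  have "bino u (Suc a) (\<lambda>i. real i * c i)
      = (1 - u) * bino u a (\<lambda>i. real i * c i) + u * bino u a (\<lambda>i. real i * c (Suc i) + c (Suc i))"
    by (simp add: algebra_simps)
  also have "\<dots> = real a * u * ((1 - u) * bino u (a - 1) (\<lambda>i. c (Suc i)) + u * bino u (a - 1) (\<lambda>i. c (Suc (Suc i))))
      + u * bino u a (\<lambda>i. c (Suc i))"
    unfolding bino_add Suc.IH by (simp add: algebra_simps)
  also have "\<dots> = real a * u * bino u a (\<lambda>i. c (Suc i)) + u * bino u a (\<lambda>i. c (Suc i))"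
    by (cases a) auto
  finally show ?case by (simp add: algebra_simps)
qed simp

text \<open>Size biasing read backwards: the left side is the probability that a binomial variable
  with \<open>a + 1\<close> trials is nonzero, as \<open>i * (1 / i)\<close> is 0 at 0 and 1
  elsewhere.\<close>

lemma bino_inverse_le:
  assumes "0 \<le> u" "u \<le> 1"
  shows "(real a + 1) * u * bino u a (\<lambda>i. 1 / (real i + 1)) \<le> 1"
proof -
  have "bino u (Suc a) (\<lambda>i. real i * (1 / real i)) \<le> bino u (Suc a) (\<lambda>i. 1)"
    using assms by (intro bino_mono) auto
  also have "\<dots> = 1" by (rule bino_const)
  finally show ?thesis unfolding bino_times_index by (simp add: add.commute)
qed

lemma bino_variance: "bino u a (\<lambda>i. (real i - real a * u)\<^sup>2) = real a * u * (1 - u)"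
proof -
  have m: "bino u n real = real n * u" for n
    using bino_times_index [of u n "\<lambda>_. 1"] by simp
  have s: "bino u a (\<lambda>i. real i * real i) = real a * u * (real (a - 1) * u + 1)"
    unfolding bino_times_index using bino_add [of u "a - 1" real "\<lambda>_. 1"] by (simp add: m add.commute)
  have "bino u a (\<lambda>i. (real i - real a * u)\<^sup>2)
      = bino u a (\<lambda>i. (real i * real i + (- 2 * real a * u) * real i) + (real a * u)\<^sup>2)"
    by (simp add: power2_eq_square algebra_simps)
  also have "\<dots> = real a * u * (real (a - 1) * u + 1) + - 2 * real a * u * (real a * u) + (real a * u)\<^sup>2"
    by (simp only: bino_add bino_cmult bino_const m s)
  also have "\<dots> = real a * u * (1 - u)"
    by (cases a) (auto simp: power2_eq_square algebra_simps)
  finally show ?thesis .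
qed

section \<open>A differential equation for the depth law given the insertion time\<close>

text \<open>Passing from \<open>a\<close> to \<open>a + 1\<close> adds exactly
  \<open>bino u a e\<close>, by size biasing. The assumption has the form of the recursion for
  records, whose binomial averages thus become sums over smaller sizes, as in a split at the
  root.\<close>

lemma bino_telescope:
  assumes "\<And>i. (real i + 1) * c (Suc i) = real i * c i + e i"
  shows "real a * bino u (a - 1) (\<lambda>i. c (Suc i)) = (\<Sum>k<a. bino u k e)"
proof (induction a)
  case (Suc a)
  let ?c1 = "\<lambda>i. c (Suc i)" and ?c2 = "\<lambda>i. c (Suc (Suc i))"
  have "e = (\<lambda>i. real i * ?c1 i + ?c1 i - real i * c i)"
    using assms by (auto simp: fun_eq_iff algebra_simps)
  hence "bino u a e = real a * u * bino u (a - 1) ?c2 + bino u a ?c1 - real a * u * bino u (a - 1) ?c1"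
    by (simp only: bino_add bino_diff bino_times_index)
  also have "\<dots> = (real a + 1) * bino u a ?c1 - real a * bino u (a - 1) ?c1"
    by (cases a) (auto simp: algebra_simps)
  finally show ?case using Suc by (simp add: algebra_simps)
qed simp

text \<open>To first order a change of \<open>u\<close> flips one of the \<open>a\<close> trials.
  The second term allows the integrand to depend on \<open>u\<close>, which happens because
  \<open>depth_mix\<close> nests two averages.\<close>

lemma bino_has_derivative:
  assumes "\<And>i. ((\<lambda>u. h u i) has_real_derivative h' i) (at u)"
  shows "((\<lambda>u. bino u a (h u)) has_real_derivative
    real a * bino u (a - 1) (\<lambda>i. h u (Suc i) - h u i) + bino u a h') (at u)"
  using assms
proof (induction a arbitrary: h h')
  case (Suc a)
  let ?S = "\<lambda>c i. c (Suc i)"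
  have 1: "((\<lambda>u. (1 - u) * bino u a (h u) + u * bino u a (?S (h u))) has_real_derivative
      (1 - u) * (real a * bino u (a - 1) (\<lambda>i. h u (Suc i) - h u i) + bino u a h') + - 1 * bino u a (h u)
      + (u * (real a * bino u (a - 1) (\<lambda>i. h u (Suc (Suc i)) - h u (Suc i)) + bino u a (?S h'))
      + 1 * bino u a (?S (h u)))) (at u)"
    by (intro DERIV_add DERIV_mult' Suc.IH Suc.prems) (auto intro!: derivative_eq_intros)
  have "real a * ((1 - u) * bino u (a - 1) (\<lambda>i. h u (Suc i) - h u i)
        + u * bino u (a - 1) (\<lambda>i. h u (Suc (Suc i)) - h u (Suc i)))
      = real a * bino u a (\<lambda>i. h u (Suc i) - h u i)"
    by (cases a) auto
  hence "(1 - u) * (real a * bino u (a - 1) (\<lambda>i. h u (Suc i) - h u i) + bino u a h') + - 1 * bino u a (h u)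
      + (u * (real a * bino u (a - 1) (\<lambda>i. h u (Suc (Suc i)) - h u (Suc i)) + bino u a (?S h'))
      + 1 * bino u a (?S (h u)))
      = real (Suc a) * bino u (Suc a - 1) (\<lambda>i. h u (Suc i) - h u i) + bino u (Suc a) h'"
    by (simp add: bino_diff [of u a] algebra_simps)
  with 1 show ?case by simp
qed simp

text \<open>The law of the depth of a key with \<open>a\<close> smaller and \<open>b\<close> larger keys, given that the insertion
  time of the key, among independent uniform ones, is \<open>u\<close>: its ancestors are the records among the smaller
  and among the larger keys inserted earlier.\<close>

definition depth_mix :: "real \<Rightarrow> nat \<Rightarrow> nat \<Rightarrow> (nat \<Rightarrow> real) \<Rightarrow> nat \<Rightarrow> real" where
  "depth_mix u a b f x = bino u a (\<lambda>i. bino u b (\<lambda>j. recs i (recs j f) x))"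

text \<open>The factor \<open>1 - u\<close> lets the unshifted terms of the derivative cancel, after
  which telescoping applies on each side of the key. The right side is a split at the root: a
  smaller root leaves some \<open>k < a\<close> smaller keys and all \<open>b\<close> larger ones,
  and the edge below the root appears as \<open>Suc x\<close>.\<close>

lemma depth_mix_has_derivative:
  obtains D where "((\<lambda>u. depth_mix u a b f x) has_real_derivative D) (at u)"
    "(1 - u) * D + (real a + real b) * depth_mix u a b f x
      = (\<Sum>k<a. depth_mix u k b f (Suc x)) + (\<Sum>k<b. depth_mix u a k f (Suc x))"
proof
  define c where "c i j = recs i (recs j f) x" for i j
  define B where "B u i = bino u b (c i)" for u i
  define B' where "B' i = real b * bino u (b - 1) (\<lambda>j. c i (Suc j) - c i j)" for i
  let ?D = "real a * bino u (a - 1) (\<lambda>i. B u (Suc i) - B u i) + bino u a B'"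
  have dB: "((\<lambda>u. B u i) has_real_derivative B' i) (at u)" for i
    using bino_has_derivative [of "\<lambda>u. c i" "\<lambda>_. 0" u b] by (simp add: B_def B'_def)
  have eq: "depth_mix u a b f x = bino u a (B u)" for u
  proof -
    have "B u = (\<lambda>i. bino u b (\<lambda>j. recs i (recs j f) x))"
      by (simp add: B_def c_def [abs_def] fun_eq_iff)
    thus ?thesis by (simp add: depth_mix_def)
  qed
  show "((\<lambda>u. depth_mix u a b f x) has_real_derivative ?D) (at u)"
    unfolding eq by (intro bino_has_derivative dB)
  \<comment> \<open>Splitting one trial off \<open>bino u n g\<close> cancels the terms in the
    unshifted \<open>g\<close>.\<close>
  have key: "(1 - u) * (real n * bino u (n - 1) (\<lambda>i. g (Suc i) - g i)) + real n * bino u n g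
      = real n * bino u (n - 1) (\<lambda>i. g (Suc i))" for n g
    by (cases n) (auto simp: bino_diff algebra_simps)
  have rec1: "(real i + 1) * recs (Suc i) g x = real i * recs i g x + recs i g (Suc x)" for i g
    by (simp add: field_simps)
  have cstep1: "(real i + 1) * c (Suc i) j = real i * c i j + recs i (recs j f) (Suc x)" for i j
    unfolding c_def by (rule rec1)
  have 1: "real a * bino u (a - 1) (\<lambda>i. B u (Suc i)) = (\<Sum>k<a. depth_mix u k b f (Suc x))"
    unfolding depth_mix_def
    by (rule bino_telescope) (simp add: B_def bino_cmult [symmetric] bino_add [symmetric] cstep1)
  have cstep2: "(real j + 1) * c i (Suc j) = real j * c i j + recs i (recs j f) (Suc x)" for i j
  proof -
    have "c i (Suc j) = recs i (\<lambda>x. real j / (real j + 1) * recs j f x + 1 / (real j + 1) * recs j f (Suc x)) x"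
      by (simp add: c_def add_divide_distrib)
    also have "\<dots> = real j / (real j + 1) * c i j + 1 / (real j + 1) * recs i (recs j f) (Suc x)"
      by (simp only: recs_linear recs_shift c_def)
    finally have "c i (Suc j) = (real j * c i j + recs i (recs j f) (Suc x)) / (real j + 1)"
      by (simp add: add_divide_distrib)
    moreover have "real j + 1 \<noteq> 0" by linarith
    ultimately show ?thesis by simp
  qed
  have "(1 - u) * B' i + real b * B u i = (\<Sum>k<b. bino u k (\<lambda>j. recs i (recs j f) (Suc x)))" for i
    unfolding B'_def B_def key by (rule bino_telescope) (rule cstep2)
  hence "bino u a (\<lambda>i. (1 - u) * B' i + real b * B u i) = (\<Sum>k<b. depth_mix u a k f (Suc x))"
    by (simp add: bino_sum depth_mix_def)
  hence 2: "(1 - u) * bino u a B' + real b * bino u a (B u) = (\<Sum>k<b. depth_mix u a k f (Suc x))"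
    by (simp only: bino_linear)
  show "(1 - u) * ?D + (real a + real b) * depth_mix u a b f x
      = (\<Sum>k<a. depth_mix u k b f (Suc x)) + (\<Sum>k<b. depth_mix u a k f (Suc x))"
    using key [of a "B u"] 1 2 unfolding eq by (simp add: algebra_simps)
qed

section \<open>Logarithms and harmonic numbers of a binomial variable\<close>

lemma inverse_sqrt_le:
  fixes m e :: real
  assumes "m > 0" "e > 0"
  shows "1 / sqrt m \<le> (e * (1 / m) + 1 / e) / 2"
  using abs_le_weighted_square [OF assms(2), of "1 / sqrt m"] assms(1)
  by (simp add: power_divide)

text \<open>Write \<open>ln q - ln p = 2 * ln (sqrt (q / p))\<close> and use
  \<open>ln z \<le> z - 1\<close>. The symmetric denominator suits the averaging: the random factor
  calls for an inverse moment only, and the other one yields the rate.\<close>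

lemma ln_diff_le_sqrt:
  fixes x y :: real
  assumes "0 < x" "0 < y"
  shows "\<bar>ln x - ln y\<bar> \<le> 2 * \<bar>x - y\<bar> / sqrt (x * y)"
proof -
  have *: "ln q - ln p \<le> 2 * (q - p) / sqrt (p * q)" if "0 < p" "p \<le> q" for p q :: real
  proof -
    have "ln q - ln p = 2 * ln (sqrt (q / p))"
      using that by (simp add: ln_sqrt ln_div)
    also have "\<dots> \<le> 2 * (sqrt (q / p) - 1)"
      using that by (intro mult_left_mono ln_le_minus_one) auto
    also have "sqrt (q / p) - 1 = (sqrt q - sqrt p) * sqrt q / sqrt (p * q)"
      using that by (simp add: real_sqrt_divide real_sqrt_mult field_simps)
    also have "(sqrt q - sqrt p) * sqrt q \<le> (sqrt q - sqrt p) * (sqrt q + sqrt p)"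
      using that by (intro mult_left_mono) auto
    also have "\<dots> = q - p" using that by (simp add: algebra_simps)
    finally show ?thesis using that by (simp add: divide_right_mono)
  qed
  show ?thesis
    using *[of x y] *[of y x] assms
    by (cases "x \<le> y") (auto simp: abs_if mult.commute)
qed

lemma ln_add_one_le_sqrt:
  fixes z :: real
  assumes "0 \<le> z"
  shows "ln (1 + z) \<le> 2 * sqrt z"
proof -
  have "1 + z \<le> (1 + sqrt z)\<^sup>2" using assms by (simp add: power2_sum)
  hence "ln (1 + z) \<le> ln ((1 + sqrt z)\<^sup>2)"
    using assms by (intro ln_mono) auto
  also have "\<dots> = 2 * ln (1 + sqrt z)" using assms by (simp add: ln_realpow add_nonneg_eq_0_iff)
  also have "\<dots> \<le> 2 * sqrt z" using assms ln_add_one_self_le_self [of "sqrt z"] by simp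
  finally show ?thesis .
qed

text \<open>The shift to \<open>i + 1\<close> includes \<open>i = 0\<close>, where the claim reads
  \<open>euler_mascheroni \<le> 1\<close>.\<close>

lemma harm_approx: "\<bar>harm i - euler_mascheroni - ln (real i + 1)\<bar> \<le> 1 / (real i + 1)"
proof (cases i)
  case 0
  thus ?thesis using euler_mascheroni_pos euler_mascheroni_less_13_over_22 by (simp add: harm_expand)
next
  case (Suc n)
  have "1 / real (2 * (n + 1)) \<le> 1 / (real i + 1)" using Suc by (intro frac_le) auto
  moreover have "1 / real (2 * (n + 2)) \<ge> 0" "1 / (real i + 1) \<ge> 0" by simp_all
  moreover have "ln (real (n + 2)) = ln (real i + 1)" using Suc by (simp add: add.commute)
  ultimately show ?thesis
    using euler_mascheroni_lower [of n] euler_mascheroni_upper [of n] unfolding Suc [symmetric] by linarith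
qed

text \<open>With \<open>m = a * u\<close>, the error is split at \<open>ln (i + 1)\<close> and
  \<open>ln (m + 1)\<close>. The pieces are dominated by multiples of \<open>1 / (i + 1)\<close>,
  \<open>(i - m)^2\<close> and 1, with weights in \<open>w = sqrt m\<close> that make every mean of
  order \<open>1 / w\<close>. The constant is \<open>5 = 3/2 + 1 + 5/2\<close>.\<close>

lemma bino_harm_approx:
  assumes "0 < u" "u \<le> 1" "a \<ge> 1"
  shows "bino u a (\<lambda>i. \<bar>harm i - euler_mascheroni - ln (real a * u)\<bar>) \<le> 5 / sqrt (real a * u)"
proof -
  define m where "m = real a * u"
  define w where "w = sqrt m"
  have m: "m > 0" using assms by (simp add: m_def)
  have w: "w > 0" "m = w\<^sup>2" using m by (auto simp: w_def)
  have pt: "\<bar>harm i - euler_mascheroni - ln m\<bar>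
      \<le> 3/2 * w * (1 / (real i + 1)) + (1 / (m * w) * (real i - m)\<^sup>2 + 5/2 / w)" for i
  proof -
    define x y where "x = real i + 1" and "y = m + 1"
    have xy: "x \<ge> 1" "y \<ge> 1" using m by (auto simp: x_def y_def)
    have "sqrt x * 1 \<le> sqrt x * sqrt x" using xy by (intro mult_left_mono) auto
    hence "sqrt x \<le> x" using xy by simp
    hence "1 / x \<le> 1 / sqrt x" using xy by (intro divide_left_mono) auto
    also have "1 / sqrt x \<le> (w * (1 / x) + 1 / w) / 2" by (rule inverse_sqrt_le) (use xy w in auto)
    finally have A: "\<bar>harm i - euler_mascheroni - ln x\<bar> \<le> (w * (1 / x) + 1 / w) / 2"
      using harm_approx [of i] by (simp add: x_def)
    have "2 * (\<bar>x - y\<bar> / sqrt x) = 2 * (\<bar>x - y\<bar> / w) * (w / sqrt x)" using w by simp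
    also have "\<dots> \<le> (\<bar>x - y\<bar> / w)\<^sup>2 + (w / sqrt x)\<^sup>2" by (rule sum_squares_bound)
    also have "\<dots> = (x - y)\<^sup>2 / m + m * (1 / x)" using w xy by (simp add: power_divide)
    finally have B0: "2 * (\<bar>x - y\<bar> / sqrt x) \<le> (x - y)\<^sup>2 / m + m * (1 / x)" .
    have "\<bar>ln x - ln y\<bar> \<le> 2 * \<bar>x - y\<bar> / sqrt (x * y)" by (rule ln_diff_le_sqrt) (use xy in auto)
    also have "\<dots> = 2 * (\<bar>x - y\<bar> / sqrt x) / sqrt y"
      by (simp only: real_sqrt_mult times_divide_eq_right divide_divide_eq_left)
    also have "\<dots> \<le> 2 * (\<bar>x - y\<bar> / sqrt x) / w"
      using xy m w(1) by (intro divide_left_mono) (auto simp: w_def y_def)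
    also have "\<dots> \<le> ((x - y)\<^sup>2 / m + m * (1 / x)) / w"
      using w by (intro divide_right_mono B0) auto
    also have "\<dots> = 1 / (m * w) * (x - y)\<^sup>2 + w * (1 / x)"
      using w m by (simp add: add_divide_distrib power2_eq_square)
    finally have B: "\<bar>ln x - ln y\<bar> \<le> 1 / (m * w) * (x - y)\<^sup>2 + w * (1 / x)" .
    have "1 + 1 / m = y / m" using m by (simp add: y_def add_divide_distrib)
    hence "ln y - ln m = ln (1 + 1 / m)" using m xy by (simp add: ln_div)
    also have "\<dots> \<le> 2 * sqrt (1 / m)" using m by (intro ln_add_one_le_sqrt) auto
    finally have C: "ln y - ln m \<le> 2 * (1 / w)" by (simp add: w_def real_sqrt_divide)
    have "ln y \<ge> ln m" using m by (simp add: y_def)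
    hence "\<bar>harm i - euler_mascheroni - ln m\<bar>
        \<le> (w * (1 / x) + 1 / w) / 2 + (1 / (m * w) * (x - y)\<^sup>2 + w * (1 / x)) + 2 * (1 / w)"
      using A B C by linarith
    also have "\<dots> = 3/2 * w * (1 / x) + (1 / (m * w) * (x - y)\<^sup>2 + 5/2 / w)" by (simp add: field_simps)
    finally show ?thesis by (simp add: x_def y_def)
  qed
  have inv: "m * bino u a (\<lambda>i. 1 / (real i + 1)) \<le> 1"
  proof -
    have "0 \<le> bino u a (\<lambda>i. 1 / (real i + 1))"
      using bino_mono [of u "\<lambda>_. 0" "\<lambda>i. 1 / (real i + 1)" a] assms by simp
    hence "m * bino u a (\<lambda>i. 1 / (real i + 1)) \<le> (real a + 1) * u * bino u a (\<lambda>i. 1 / (real i + 1))"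
      using assms by (intro mult_right_mono) (auto simp: m_def)
    also have "\<dots> \<le> 1" using assms by (intro bino_inverse_le) auto
    finally show ?thesis .
  qed
  have "bino u a (\<lambda>i. \<bar>harm i - euler_mascheroni - ln m\<bar>)
      \<le> bino u a (\<lambda>i. 3/2 * w * (1 / (real i + 1)) + (1 / (m * w) * (real i - m)\<^sup>2 + 5/2 / w))"
    using assms by (intro bino_mono pt) auto
  also have "\<dots> = 3/2 * w * bino u a (\<lambda>i. 1 / (real i + 1)) + (1 / (m * w) * (m * (1 - u)) + 5/2 / w)"
    by (simp only: bino_add bino_cmult bino_const bino_variance m_def)
  also have "3/2 * w * bino u a (\<lambda>i. 1 / (real i + 1)) = 3/2 / w * (m * bino u a (\<lambda>i. 1 / (real i + 1)))"
    using w by (simp add: power2_eq_square)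
  also have "\<dots> \<le> 3/2 / w * 1" using w by (intro mult_left_mono inv) auto
  also have "1 / (m * w) * (m * (1 - u)) \<le> 1 / w"
    using m w assms by (simp add: divide_right_mono)
  finally show ?thesis by (simp add: w_def m_def field_simps)
qed

text \<open>For \<open>i \<ge> 1\<close> the root of \<open>ln (a + 1) / ln (i + 1)\<close> is at
  most \<open>1 + 2 * sqrt ((a + 1) / (i + 1))\<close>, because the logarithms differ by at most
  \<open>(a + 1) / (i + 1)\<close> and \<open>ln (i + 1) \<ge> 1/4\<close>. Averaging
  \<open>1 / sqrt (i + 1)\<close> then costs the factor \<open>1 / sqrt u\<close>.\<close>

lemma bino_inverse_sqrt_ln:
  assumes "0 < u" "u \<le> 1" "a \<ge> 1"
  shows "bino u a (\<lambda>i. 1 / sqrt (ln (real i + 1))) \<le> 3 / (sqrt u * sqrt (ln (real a + 1)))"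
proof -
  define L where "L = sqrt (ln (real a + 1))"
  define m where "m = real a + 1"
  define e where "e = sqrt (m * u)"
  have pos: "L > 0" "e > 0" "m > 0" using assms by (auto simp: L_def e_def m_def)
  have pt: "L * (1 / sqrt (ln (real i + 1))) \<le> 1 + sqrt m * (e * (1 / (real i + 1)) + 1 / e)" for i
  proof (cases "i = 0")
    \<comment> \<open>The left side is 0 here, since \<open>ln 1 = 0\<close> and
      \<open>1 / 0 = 0\<close>. This fits the use of the term: without records there is no
      approximation error.\<close>
    case True
    thus ?thesis using pos by simp
  next
    case False
    define l where "l = ln (real i + 1)"
    have "ln (2::real) \<le> l" using False by (simp add: l_def)
    hence l: "l \<ge> 1/4" using ln2_ge_two_thirds by linarith
    have r: "ln (real a + 1) = l + ln (m / (real i + 1))"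
      by (simp add: l_def m_def ln_div)
    have "ln (m / (real i + 1)) \<le> m / (real i + 1)"
      using ln_le_minus_one [of "m / (real i + 1)"] pos by simp
    with r have "L \<le> sqrt (l + m / (real i + 1))" by (simp add: L_def)
    also have "\<dots> \<le> sqrt l + sqrt (m / (real i + 1))"
      using l pos by (intro sqrt_add_le_add_sqrt) auto
    finally have "L / sqrt l \<le> (sqrt l + sqrt (m / (real i + 1))) / sqrt l"
      using l by (intro divide_right_mono) auto
    also have "\<dots> = 1 + sqrt (m / (real i + 1)) / sqrt l"
      using l by (simp add: add_divide_distrib)
    also have "sqrt (m / (real i + 1)) / sqrt l \<le> sqrt (m / (real i + 1)) / sqrt (1/4)"
      using l pos by (intro divide_left_mono) auto
    also have "sqrt (1/4 :: real) = 1/2" by (simp add: real_sqrt_divide)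
    also have "sqrt (m / (real i + 1)) / (1/2) = 2 * sqrt m * (1 / sqrt (real i + 1))"
      by (simp add: real_sqrt_divide)
    also have "\<dots> \<le> 2 * sqrt m * ((e * (1 / (real i + 1)) + 1 / e) / 2)"
      using pos by (intro mult_left_mono inverse_sqrt_le) auto
    finally show ?thesis by (simp add: l_def)
  qed
  have "L * bino u a (\<lambda>i. 1 / sqrt (ln (real i + 1)))
      \<le> bino u a (\<lambda>i. 1 + sqrt m * (e * (1 / (real i + 1)) + 1 / e))"
    unfolding bino_cmult [symmetric] using assms by (intro bino_mono pt) auto
  also have "\<dots> = 1 + sqrt m * (e * bino u a (\<lambda>i. 1 / (real i + 1)) + 1 / e)"
    by (simp only: bino_add bino_cmult bino_const)
  also have "e * bino u a (\<lambda>i. 1 / (real i + 1)) = (e * e * bino u a (\<lambda>i. 1 / (real i + 1))) / e"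
    using pos by simp
  also have "e * e = m * u" using pos assms by (simp add: e_def)
  also have "(m * u * bino u a (\<lambda>i. 1 / (real i + 1))) / e \<le> 1 / e"
    using assms pos bino_inverse_le [of u a] by (intro divide_right_mono) (auto simp: m_def)
  also have "sqrt m * (1 / e + 1 / e) = 2 / sqrt u"
    using pos assms by (simp add: e_def real_sqrt_mult)
  also have "1 \<le> 1 / sqrt u" using assms by simp
  finally have "L * bino u a (\<lambda>i. 1 / sqrt (ln (real i + 1))) \<le> 3 / sqrt u"
    using pos by simp
  thus ?thesis using pos assms by (simp add: L_def field_simps)
qed

section \<open>The recursion for the depth\<close>

lemma depth_mix_zero: "depth_mix 0 a b f x = f x"
proof -
  have "bino 0 n c = c 0" for n c by (induction n) auto
  thus ?thesis by (simp add: depth_mix_def)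
qed

lemma depth_mix_abs_le:
  assumes "0 \<le> u" "u \<le> 1" "\<And>k. \<bar>f k\<bar> \<le> B"
  shows "\<bar>depth_mix u a b f x\<bar> \<le> B"
proof -
  have "\<bar>bino u n c\<bar> \<le> B" if "\<And>i. \<bar>c i\<bar> \<le> B" for n c
    using bino_abs_le [OF assms(1,2), of n c] bino_mono [OF assms(1,2), of "\<lambda>i. \<bar>c i\<bar>" "\<lambda>_. B" n] that
    by fastforce
  thus ?thesis unfolding depth_mix_def by (simp add: recs_abs_le assms(3))
qed

lemma isCont_depth_mix: "isCont (\<lambda>u. depth_mix u a b f x) u"
  by (rule depth_mix_has_derivative [of a b f x u]) (rule DERIV_isCont)

section \<open>Averages over the standard exponential law\<close>

lemma prob_space_Exp1: "prob_space Exp1"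
  unfolding Exp1_def by (rule prob_space_exponential_density) simp

lemma sets_Exp1 [simp, measurable_cong]: "sets Exp1 = sets borel"
  by (simp add: Exp1_def)

lemma space_Exp1 [simp]: "space Exp1 = UNIV"
  by (simp add: Exp1_def)

lemma AE_Exp1_nonneg: "AE y in Exp1. 0 \<le> y"
  unfolding Exp1_def by (subst AE_density) (auto simp: exponential_density_def)

lemma integrable_Exp1_bounded:
  fixes h :: "real \<Rightarrow> real"
  assumes "h \<in> borel_measurable borel" "\<And>y. 0 \<le> y \<Longrightarrow> \<bar>h y\<bar> \<le> B"
  shows "integrable Exp1 h"
proof -
  interpret prob_space Exp1 by (rule prob_space_Exp1)
  show ?thesis
    by (rule integrable_const_bound [of _ B]) (use assms AE_Exp1_nonneg in \<open>auto elim: eventually_mono\<close>)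
qed

lemma Exp1_integral:
  fixes h :: "real \<Rightarrow> real"
  assumes [measurable]: "h \<in> borel_measurable borel"
  shows "integrable Exp1 h \<longleftrightarrow> set_integrable lborel (einterval 0 \<infinity>) (\<lambda>y. exp (- y) * h y)"
    and "integral\<^sup>L Exp1 h = (LBINT y=0..\<infinity>. exp (- y) * h y)"
proof -
  have ind [measurable]: "einterval 0 \<infinity> \<in> sets borel" by simp
  have ae: "AE y in lborel. exponential_density 1 y * h y = indicator (einterval 0 \<infinity>) y *\<^sub>R (exp (- y) * h y)"
    using AE_lborel_singleton [of 0]
    by eventually_elim (auto simp: exponential_density_def einterval_def indicator_def)
  have nn: "AE y in lborel. 0 \<le> exponential_density 1 y"
    by (simp add: exponential_density_def)
  have "integrable lborel (\<lambda>y. exponential_density 1 y * h y)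
      \<longleftrightarrow> integrable lborel (\<lambda>y. indicator (einterval 0 \<infinity>) y *\<^sub>R (exp (- y) * h y))"
    by (rule integrable_cong_AE [OF _ _ ae]) auto
  thus "integrable Exp1 h \<longleftrightarrow> set_integrable lborel (einterval 0 \<infinity>) (\<lambda>y. exp (- y) * h y)"
    unfolding Exp1_def set_integrable_def
    by (subst integrable_real_density [OF _ nn]) auto
  have "integral\<^sup>L Exp1 h = (\<integral>y. exponential_density 1 y * h y \<partial>lborel)"
    unfolding Exp1_def by (subst integral_real_density [OF _ nn]) auto
  also have "\<dots> = (LBINT y=0..\<infinity>. exp (- y) * h y)"
    unfolding interval_lebesgue_integral_def set_lebesgue_integral_def
    by (simp, intro integral_cong_AE) (use ae in auto)
  finally show "integral\<^sup>L Exp1 h = (LBINT y=0..\<infinity>. exp (- y) * h y)" .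
qed

text \<open>At \<open>u = exp (- y)\<close> the integrand is \<open>1 / sqrt u\<close>, the factor
  lost for small insertion times. Times the density it is twice the exponential density of rate
  \<open>1/2\<close>.\<close>

lemma Exp1_exp_half:
  shows "integrable Exp1 (\<lambda>y. exp (y / 2))" and "(\<integral>y. exp (y / 2) \<partial>Exp1) = 2"
proof -
  let ?d = "exponential_density (1/2)"
  interpret P: prob_space "density lborel ?d"
    by (rule prob_space_exponential_density) simp
  have nn1: "AE y in lborel. 0 \<le> exponential_density 1 y" and nn2: "AE y in lborel. 0 \<le> ?d y"
    by (simp_all add: exponential_density_def)
  have eq: "exponential_density 1 y * exp (y / 2) = 2 * (?d y * 1)" for y :: real
    by (simp add: exponential_density_def exp_add [symmetric])
  have i: "integrable lborel (\<lambda>y. ?d y * 1)" "(\<integral>y. ?d y * 1 \<partial>lborel) = (1 :: real)"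
    using integrable_real_density [OF _ nn2, of "\<lambda>_. 1"] integral_real_density [OF _ nn2, of "\<lambda>_. 1"]
      P.prob_space by simp_all
  show "integrable Exp1 (\<lambda>y. exp (y / 2))"
    unfolding Exp1_def by (subst integrable_real_density [OF _ nn1]) (use i(1) in \<open>auto simp: eq\<close>)
  show "(\<integral>y. exp (y / 2) \<partial>Exp1) = 2"
    unfolding Exp1_def by (subst integral_real_density [OF _ nn1]) (use i(2) in \<open>auto simp: eq\<close>)
qed

text \<open>Writing the uniform insertion time as \<open>exp (- y)\<close> with exponential
  \<open>y\<close> makes the depth and the mixed Poisson law integrals over the same
  \<open>y\<close>, so that they can be compared pointwise.\<close>

definition depth_exp :: "nat \<Rightarrow> nat \<Rightarrow> (nat \<Rightarrow> real) \<Rightarrow> nat \<Rightarrow> real" where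
  "depth_exp a b f x = (\<integral>y. depth_mix (exp (- y)) a b f x \<partial>Exp1)"

lemma borel_measurable_depth_mix [measurable]:
  "(\<lambda>y. depth_mix (exp (- y)) a b f x) \<in> borel_measurable borel"
  by (intro borel_measurable_continuous_onI continuous_at_imp_continuous_on ballI
      isCont_o2 [OF _ isCont_depth_mix]) (auto intro!: continuous_intros)

lemma integrable_depth_mix:
  assumes "Bseq f"
  shows "integrable Exp1 (\<lambda>y. depth_mix (exp (- y)) a b f x)"
proof -
  obtain B where B: "B > 0" "\<And>k. \<bar>f k\<bar> \<le> B" by (rule Bseq_abs_bound [OF assms]) blast
  show ?thesis
    by (rule integrable_Exp1_bounded [of _ B]) (use B in \<open>auto intro!: depth_mix_abs_le\<close>)
qed

text \<open>The recursion is the fundamental theorem of calculus for \<open>(1 - u) * depth_mix u a b f x\<close> on \<open>[0, 1]\<close>,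
  in the variable \<open>y = - ln u\<close>.\<close>

lemma depth_exp_rec:
  assumes "Bseq f"
  shows "(real a + real b + 1) * depth_exp a b f x
    = f x + (\<Sum>k<a. depth_exp k b f (Suc x)) + (\<Sum>k<b. depth_exp a k f (Suc x))"
proof -
  define S where "S u = (\<Sum>k<a. depth_mix u k b f (Suc x)) + (\<Sum>k<b. depth_mix u a k f (Suc x))" for u
  define G where "G u = depth_mix u a b f x" for u
  \<comment> \<open>Chosen so that \<open>exp (- y) * h y\<close> is the derivative in
    \<open>y\<close> of \<open>(1 - u) * G u\<close> at \<open>u = exp (- y)\<close>; the claim says
    that \<open>h\<close> has mean \<open>f x\<close>.\<close>
  define h where "h y = (real a + real b + 1) * G (exp (- y)) - S (exp (- y))" for y
  have contG: "isCont G u" for u unfolding G_def by (rule isCont_depth_mix)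
  have contS: "isCont S u" for u
    unfolding S_def by (intro continuous_intros isCont_depth_mix)
  have meas [measurable]: "h \<in> borel_measurable borel"
    unfolding h_def G_def S_def by measurable
  have intg: "integrable Exp1 h"
    unfolding h_def G_def S_def using assms
    by (intro Bochner_Integration.integrable_diff integrable_mult_right Bochner_Integration.integrable_add
        Bochner_Integration.integrable_sum integrable_depth_mix)
  have deriv: "((\<lambda>y. (1 - exp (- y)) * G (exp (- y))) has_real_derivative exp (- y) * h y) (at y)" for y
  proof -
    obtain D where D: "(G has_real_derivative D) (at (exp (- y)))"
      "(1 - exp (- y)) * D + (real a + real b) * G (exp (- y)) = S (exp (- y))"
      unfolding G_def S_def by (rule depth_mix_has_derivative)
    have "((\<lambda>y. (1 - exp (- y)) * G (exp (- y))) has_real_derivative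
        (1 - exp (- y)) * (D * (- exp (- y))) + exp (- y) * G (exp (- y))) (at y)"
      by (intro DERIV_mult' DERIV_chain2 [where f = G and g = "\<lambda>y. exp (- y)" and x = y, OF D(1)]) (auto intro!: derivative_eq_intros)
    also have "(1 - exp (- y)) * (D * (- exp (- y))) + exp (- y) * G (exp (- y))
        = exp (- y) * (G (exp (- y)) - (1 - exp (- y)) * D)" by (simp add: algebra_simps)
    also have "G (exp (- y)) - (1 - exp (- y)) * D = h y"
      using D(2) by (simp add: h_def algebra_simps)
    finally show ?thesis .
  qed
  have conth: "isCont h y" for y
    unfolding h_def by (intro continuous_intros isCont_o2 [OF _ contG] isCont_o2 [OF _ contS])
  have contF: "isCont (\<lambda>y. (1 - exp (- y)) * G (exp (- y))) y" for y
    using deriv by (rule DERIV_isCont)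
  \<comment> \<open>At \<open>y = 0\<close> the factor \<open>1 - exp (- y)\<close> vanishes. As
    \<open>y\<close> grows, \<open>u\<close> tends to 0, where the key is the root and
    \<open>G 0 = f x\<close>.\<close>
  have "(LBINT y=0..\<infinity>. exp (- y) * h y) = f x - 0"
  proof (rule interval_integral_FTC_integrable [where F = "\<lambda>y. (1 - exp (- y)) * G (exp (- y))"])
    show "set_integrable lborel (einterval 0 \<infinity>) (\<lambda>y. exp (- y) * h y)"
      using intg Exp1_integral(1) meas by blast
    show "(((\<lambda>y. (1 - exp (- y)) * G (exp (- y))) \<circ> real_of_ereal) \<longlongrightarrow> 0) (at_right 0)"
      using contF [of 0] unfolding zero_ereal_def ereal_tendsto_simps1
      by (simp add: isCont_def filterlim_at_split)
    have e: "((\<lambda>y::real. exp (- y)) \<longlongrightarrow> 0) at_top"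
      by (intro filterlim_compose [OF exp_at_bot] filterlim_uminus_at_bot_at_top)
    have "((\<lambda>y. (1 - exp (- y)) * G (exp (- y))) \<longlongrightarrow> (1 - 0) * G 0) at_top"
      by (intro tendsto_intros e isCont_tendsto_compose [OF contG])
    thus "(((\<lambda>y. (1 - exp (- y)) * G (exp (- y))) \<circ> real_of_ereal) \<longlongrightarrow> f x) (at_left \<infinity>)"
      unfolding ereal_tendsto_simps1 by (simp add: G_def depth_mix_zero)
    show "isCont (\<lambda>y. exp (- y) * h y) y" for y
      by (intro continuous_intros conth)
  qed (use deriv in \<open>auto simp: has_real_derivative_iff_has_vector_derivative\<close>)
  hence "integral\<^sup>L Exp1 h = f x" by (simp add: Exp1_integral(2))
  moreover have "integral\<^sup>L Exp1 h = (real a + real b + 1) * depth_exp a b f x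
      - ((\<Sum>k<a. depth_exp k b f (Suc x)) + (\<Sum>k<b. depth_exp a k f (Suc x)))"
    unfolding h_def G_def S_def depth_exp_def using integrable_depth_mix [OF assms]
    by (simp add: Bochner_Integration.integral_diff Bochner_Integration.integral_add
        Bochner_Integration.integral_sum)
  ultimately show ?thesis by linarith
qed

section \<open>Search trees built from random permutations\<close>

lemma fold_bst_insert_Node:
  assumes "r \<notin> set xs"
  shows "fold bst_insert xs (Node lt r rt)
    = Node (fold bst_insert (filter (\<lambda>y. y < r) xs) lt) r (fold bst_insert (filter (\<lambda>y. r < y) xs) rt)"
  using assms by (induction xs arbitrary: lt rt) auto

lemma bst_of_list_Cons:
  assumes "r \<notin> set xs"
  shows "bst_of_list (r # xs)
    = Node (bst_of_list (filter (\<lambda>y. y < r) xs)) r (bst_of_list (filter (\<lambda>y. r < y) xs))"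
  using fold_bst_insert_Node [OF assms, of Leaf Leaf] by (simp add: bst_of_list_def)

text \<open>The ranks in \<open>S\<close> run through \<open>0, ..., card S - 1\<close>. The
  induction removes the maximum because this leaves the other ranks unchanged; the mirrored version
  removes the minimum.\<close>

lemma sum_rank_less:
  fixes S :: "nat set" and g :: "nat \<Rightarrow> real"
  assumes "finite S"
  shows "(\<Sum>r\<in>S. g (card {y \<in> S. y < r})) = (\<Sum>k<card S. g k)"
  using assms
proof (induction S rule: finite_linorder_max_induct)
  case (insert b A)
  have "{y \<in> insert b A. y < b} = A" using insert by auto
  moreover have "{y \<in> insert b A. y < r} = {y \<in> A. y < r}" if "r \<in> A" for r
    using insert that by force
  moreover have "b \<notin> A" using insert by auto
  ultimately show ?case using insert by simp
qed simp

lemma sum_rank_greater: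
  fixes S :: "nat set" and g :: "nat \<Rightarrow> real"
  assumes "finite S"
  shows "(\<Sum>r\<in>S. g (card {y \<in> S. r < y})) = (\<Sum>k<card S. g k)"
  using assms
proof (induction S rule: finite_linorder_min_induct)
  case (insert b A)
  have "{y \<in> insert b A. b < y} = A" using insert by auto
  moreover have "{y \<in> insert b A. r < y} = {y \<in> A. r < y}" if "r \<in> A" for r
    using insert that by force
  moreover have "b \<notin> A" using insert by auto
  ultimately show ?case using insert by simp
qed simp

lemma map_filter_random_permutation:
  assumes "finite A"
  shows "map_pmf (filter P) (pmf_of_set (permutations_of_set A)) = pmf_of_set (permutations_of_set {x \<in> A. P x})"
proof -
  have "map_pmf (filter P) (pmf_of_set (permutations_of_set A))
      = map_pmf fst (map_pmf (partition P) (pmf_of_set (permutations_of_set A)))"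
    by (simp add: pmf.map_comp o_def)
  thus ?thesis by (simp add: partition_random_permutations [OF assms] map_fst_pair_pmf)
qed

text \<open>Condition on the root \<open>r\<close>, uniform on \<open>A\<close>. If
  \<open>l < r\<close>, then \<open>l\<close> lies in the left subtree together with all smaller
  keys and the larger keys below \<open>r\<close>, and that subtree comes from a uniform permutation
  of its keys. This is the recursion of \<open>depth_exp_rec\<close>, so induction on the size
  applies; \<open>A\<close> is a general set because a right subtree does not hold an initial
  segment.\<close>

lemma expectation_node_depth:
  assumes "finite A" "l \<in> A" "Bseq f"
  shows "measure_pmf.expectation (pmf_of_set (permutations_of_set A)) (\<lambda>xs. f (x + node_depth l (bst_of_list xs)))
    = depth_exp (card {y \<in> A. y < l}) (card {y \<in> A. l < y}) f x"
  using assms(1,2)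
proof (induction "card A" arbitrary: A x rule: less_induct)
  case less
  define E :: "nat set \<Rightarrow> (nat list \<Rightarrow> real) \<Rightarrow> real"
    where "E A = measure_pmf.expectation (pmf_of_set (permutations_of_set A))" for A
  define L R where "L = {y \<in> A. y < l}" and "R = {y \<in> A. l < y}"
  have fin [simp]: "finite A" "finite L" "finite R" using less by (auto simp: L_def R_def)
  have A: "A = insert l (L \<union> R)" "l \<notin> L \<union> R" "L \<inter> R = {}" using less by (auto simp: L_def R_def)
  have cardA: "real (card A) = real (card L) + real (card R) + 1"
    using fin A by (simp add: card_Un_disjoint)
  let ?F = "\<lambda>x xs. f (x + node_depth l (bst_of_list xs))"
  have mapE: "E (A - {r}) (\<lambda>xs. h (filter P xs)) = E {y \<in> A. y \<noteq> r \<and> P y} h"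
    for r P and h :: "nat list \<Rightarrow> real"
  proof -
    have "E (A - {r}) (\<lambda>xs. h (filter P xs))
        = measure_pmf.expectation (map_pmf (filter P) (pmf_of_set (permutations_of_set (A - {r})))) h"
      by (simp add: E_def)
    also have "\<dots> = E {y \<in> A - {r}. P y} h"
      unfolding E_def by (subst map_filter_random_permutation) auto
    finally show ?thesis by (simp add: conj_commute conj_left_commute)
  qed
  have congE: "E A' g = E A' h" if "finite A'" "\<And>xs. xs \<in> permutations_of_set A' \<Longrightarrow> g xs = h xs" for A' and g h :: "nat list \<Rightarrow> real"
    unfolding E_def using that by (intro integral_cong_AE AE_pmfI) (auto simp: set_pmf_of_set)
  have root: "E (A - {r}) (\<lambda>xs. ?F x (r # xs)) =
      (if r = l then f x
       else if l < r then depth_exp (card L) (card {y \<in> R. y < r}) f (Suc x)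
       else depth_exp (card {y \<in> L. r < y}) (card R) f (Suc x))" if "r \<in> A" for r
  proof -
    have notin: "r \<notin> set xs" if "xs \<in> permutations_of_set (A - {r})" for xs
      using that by (auto simp: permutations_of_set_def)
    consider "r = l" | "l < r" | "r < l" by linarith
    thus ?thesis
    proof cases
      case 1
      have "E (A - {r}) (\<lambda>xs. ?F x (r # xs)) = E (A - {r}) (\<lambda>_. f x)"
        by (intro congE) (auto simp: bst_of_list_Cons notin [unfolded 1] 1)
      thus ?thesis using 1 by (simp add: E_def)
    next
      case 2
      have "E (A - {r}) (\<lambda>xs. ?F x (r # xs)) = E (A - {r}) (\<lambda>xs. ?F (Suc x) (filter (\<lambda>y. y < r) xs))"
        using 2 by (intro congE) (auto simp: bst_of_list_Cons notin)
      also have "\<dots> = E {y \<in> A. y \<noteq> r \<and> y < r} (?F (Suc x))"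
        by (rule mapE [where h = "?F (Suc x)"])
      also have "{y \<in> A. y \<noteq> r \<and> y < r} = {y \<in> A. y < r}" by auto
      also have "E {y \<in> A. y < r} (?F (Suc x)) = depth_exp (card {y \<in> {y \<in> A. y < r}. y < l}) (card {y \<in> {y \<in> A. y < r}. l < y}) f (Suc x)"
        unfolding E_def
        by (rule less.hyps) (use 2 that less.prems in \<open>auto intro!: psubset_card_mono\<close>)
      also have "{y \<in> {y \<in> A. y < r}. y < l} = L" using 2 by (auto simp: L_def)
      also have "{y \<in> {y \<in> A. y < r}. l < y} = {y \<in> R. y < r}" by (auto simp: R_def)
      finally show ?thesis using 2 by simp
    next
      case 3
      have "E (A - {r}) (\<lambda>xs. ?F x (r # xs)) = E (A - {r}) (\<lambda>xs. ?F (Suc x) (filter (\<lambda>y. r < y) xs))"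
        using 3 by (intro congE) (auto simp: bst_of_list_Cons notin)
      also have "\<dots> = E {y \<in> A. y \<noteq> r \<and> r < y} (?F (Suc x))"
        by (rule mapE [where h = "?F (Suc x)"])
      also have "{y \<in> A. y \<noteq> r \<and> r < y} = {y \<in> A. r < y}" by auto
      also have "E {y \<in> A. r < y} (?F (Suc x)) = depth_exp (card {y \<in> {y \<in> A. r < y}. y < l}) (card {y \<in> {y \<in> A. r < y}. l < y}) f (Suc x)"
        unfolding E_def
        by (rule less.hyps) (use 3 that less.prems in \<open>auto intro!: psubset_card_mono\<close>)
      also have "{y \<in> {y \<in> A. r < y}. l < y} = R" using 3 by (auto simp: R_def)
      also have "{y \<in> {y \<in> A. r < y}. y < l} = {y \<in> L. r < y}" by (auto simp: L_def)
      finally show ?thesis using 3 by simp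
    qed
  qed
  have ne: "A \<noteq> {}" using less by auto
  have "E A (?F x) = (\<Sum>r\<in>A. E (A - {r}) (\<lambda>xs. ?F x (r # xs)) / real (card A))"
    unfolding E_def using ne
    by (subst random_permutation_of_set)
       (auto simp: pmf_expectation_bind_pmf_of_set map_pmf_def [symmetric] divide_inverse mult.commute)
  hence "real (card A) * E A (?F x) = (\<Sum>r\<in>A. E (A - {r}) (\<lambda>xs. ?F x (r # xs)))"
    using ne by (simp add: sum_divide_distrib [symmetric])
  also have "\<dots> = f x + (\<Sum>r\<in>L. depth_exp (card {y \<in> L. r < y}) (card R) f (Suc x))
      + (\<Sum>r\<in>R. depth_exp (card L) (card {y \<in> R. y < r}) f (Suc x))"
  proof -
    have split: "sum g A = g l + (sum g L + sum g R)" for g :: "nat \<Rightarrow> real"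
      by (subst A(1)) (use A fin in \<open>simp add: sum.union_disjoint\<close>)
    have "(\<Sum>r\<in>A. E (A - {r}) (\<lambda>xs. ?F x (r # xs)))
        = E (A - {l}) (\<lambda>xs. ?F x (l # xs)) + ((\<Sum>r\<in>L. E (A - {r}) (\<lambda>xs. ?F x (r # xs)))
          + (\<Sum>r\<in>R. E (A - {r}) (\<lambda>xs. ?F x (r # xs))))"
      by (rule split)
    moreover have "E (A - {l}) (\<lambda>xs. ?F x (l # xs)) = f x" using root less.prems by simp
    moreover have "(\<Sum>r\<in>L. E (A - {r}) (\<lambda>xs. ?F x (r # xs)))
        = (\<Sum>r\<in>L. depth_exp (card {y \<in> L. r < y}) (card R) f (Suc x))"
      by (rule sum.cong) (auto simp: root L_def)
    moreover have "(\<Sum>r\<in>R. E (A - {r}) (\<lambda>xs. ?F x (r # xs)))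
        = (\<Sum>r\<in>R. depth_exp (card L) (card {y \<in> R. y < r}) f (Suc x))"
      by (rule sum.cong) (auto simp: root R_def)
    ultimately show ?thesis by simp
  qed
  also have "\<dots> = real (card A) * depth_exp (card L) (card R) f x"
    unfolding cardA depth_exp_rec [OF assms(3)]
    using sum_rank_greater [of L "\<lambda>k. depth_exp k (card R) f (Suc x)"]
      sum_rank_less [of R "\<lambda>k. depth_exp (card L) k f (Suc x)"] by simp
  finally show ?case using ne by (simp add: E_def L_def R_def)
qed

section \<open>Comparison with the mixed Poisson distribution\<close>

text \<open>The records among the larger keys are replaced first, with \<open>mu = 0\<close>, those
  among the smaller keys next, with \<open>mu = harm j\<close>; changing the resulting Poisson
  parameter has a Lipschitz cost. Truncating \<open>c\<close> at 0 only brings it closer to the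
  nonnegative \<open>harm j + harm i\<close>.\<close>

lemma depth_mix_pois_bound:
  obtains C where "C > 0"
    "\<And>f u a b c x. bdd_lip1 f \<Longrightarrow> 0 < u \<Longrightarrow> u \<le> 1 \<Longrightarrow> a \<ge> 1 \<Longrightarrow> b \<ge> 1 \<Longrightarrow>
      \<bar>depth_mix u a b f x - pois (max 0 c) f x\<bar>
      \<le> (C / sqrt (ln (real a + 1)) + C / sqrt (ln (real b + 1))) / sqrt u
        + \<bar>c - (2 * euler_mascheroni + ln (real a * u) + ln (real b * u))\<bar>"
proof -
  obtain C where C: "C > 0" "\<And>f mu i x. bdd_lip1 f \<Longrightarrow> 0 \<le> mu \<Longrightarrow>
    \<bar>recs i (pois mu f) x - pois (mu + harm i) f x\<bar> \<le> C / sqrt (ln (real i + 1))"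
    by (rule recs_pois_bound) blast
  define P where "P u a i = C * (1 / sqrt (ln (real i + 1)))
    + \<bar>harm i - euler_mascheroni - ln (real a * u)\<bar>" for u a i
  have P_le: "bino u a (P u a) \<le> (3 * C + 5) / sqrt (ln (real a + 1)) / sqrt u"
    if "0 < u" "u \<le> 1" "a \<ge> 1" for u a
  proof -
    have "bino u a (P u a) = C * bino u a (\<lambda>i. 1 / sqrt (ln (real i + 1)))
        + bino u a (\<lambda>i. \<bar>harm i - euler_mascheroni - ln (real a * u)\<bar>)"
      unfolding P_def bino_add bino_cmult ..
    also have "\<dots> \<le> C * (3 / (sqrt u * sqrt (ln (real a + 1)))) + 5 / sqrt (real a * u)"
      using C(1) that by (intro add_mono mult_left_mono bino_inverse_sqrt_ln bino_harm_approx) auto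
    \<comment> \<open>As \<open>ln (a + 1) \<le> a\<close>, the harmonic error, polynomially small
      in \<open>a\<close>, is absorbed into the logarithmic rate.\<close>
    also have "5 / sqrt (real a * u) \<le> 5 / (sqrt (ln (real a + 1)) * sqrt u)"
      unfolding real_sqrt_mult using that ln_add_one_self_le_self [of "real a"]
      by (intro divide_left_mono mult_right_mono mult_pos_pos) (auto simp: add.commute)
    finally show ?thesis by (simp add: add_divide_distrib mult.commute)
  qed
  show ?thesis
  proof
    show "3 * C + 5 > 0" using C(1) by simp
    fix f :: "nat \<Rightarrow> real" and u :: real and a b x :: nat and c :: real
    assume f: "bdd_lip1 f" and u: "0 < u" "u \<le> 1" and ab: "a \<ge> 1" "b \<ge> 1"
    define d where "d = \<bar>c - (2 * euler_mascheroni + ln (real a * u) + ln (real b * u))\<bar>"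
    have pt: "\<bar>recs i (recs j f) x - pois (max 0 c) f x\<bar> \<le> P u a i + (P u b j + d)" for i j
    proof -
      have [simp]: "pois 0 f = f" by (simp add: fun_eq_iff)
      have "\<bar>recs i (\<lambda>x. recs j f x - pois (harm j) f x) x\<bar> \<le> C / sqrt (ln (real j + 1))"
        using C(2) [OF f, of 0 j] by (intro recs_abs_le) simp
      hence 1: "\<bar>recs i (recs j f) x - recs i (pois (harm j) f) x\<bar> \<le> C / sqrt (ln (real j + 1))"
        by (simp add: recs_diff)
      have 2: "\<bar>recs i (pois (harm j) f) x - pois (harm j + harm i) f x\<bar> \<le> C / sqrt (ln (real i + 1))"
        by (intro C(2) f harm_nonneg)
      have 3: "\<bar>pois (harm j + harm i) f x - pois (max 0 c) f x\<bar> \<le> \<bar>harm j + harm i - max 0 c\<bar>"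
        by (intro pois_lipschitz f) (auto intro!: add_nonneg_nonneg harm_nonneg)
      have "harm j + harm i \<ge> (0::real)" by (intro add_nonneg_nonneg harm_nonneg)
      hence "\<bar>harm j + harm i - max 0 c\<bar> \<le> \<bar>harm j + harm i - c\<bar>" by linarith
      also have "\<bar>harm j + harm i - c\<bar> \<le> \<bar>harm i - euler_mascheroni - ln (real a * u)\<bar>
          + \<bar>harm j - euler_mascheroni - ln (real b * u)\<bar> + d"
        unfolding d_def by linarith
      finally have 4: "\<bar>harm j + harm i - max 0 c\<bar> \<le> \<bar>harm i - euler_mascheroni - ln (real a * u)\<bar>
          + \<bar>harm j - euler_mascheroni - ln (real b * u)\<bar> + d" .
      have tri: "\<bar>p - s\<bar> \<le> \<bar>p - q\<bar> + (\<bar>q - r\<bar> + \<bar>r - s\<bar>)" for p q r s :: real by linarith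
      have "\<bar>recs i (recs j f) x - pois (max 0 c) f x\<bar>
          \<le> C / sqrt (ln (real j + 1)) + (C / sqrt (ln (real i + 1))
            + (\<bar>harm i - euler_mascheroni - ln (real a * u)\<bar>
              + \<bar>harm j - euler_mascheroni - ln (real b * u)\<bar> + d))"
        by (rule order_trans [OF tri add_mono [OF 1 add_mono [OF 2 order_trans [OF 3 4]]]])
      thus ?thesis unfolding P_def by simp
    qed
    have "depth_mix u a b f x - pois (max 0 c) f x
        = bino u a (\<lambda>i. bino u b (\<lambda>j. recs i (recs j f) x - pois (max 0 c) f x))"
      by (simp add: depth_mix_def bino_diff)
    also have "\<bar>\<dots>\<bar> \<le> bino u a (\<lambda>i. bino u b (\<lambda>j. P u a i + (P u b j + d)))"
      using u by (intro order_trans [OF bino_abs_le] bino_mono pt) auto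
    also have "\<dots> = bino u a (P u a) + (bino u b (P u b) + d)"
      by (simp only: bino_add bino_const)
    also have "\<dots> \<le> (3 * C + 5) / sqrt (ln (real a + 1)) / sqrt u
        + ((3 * C + 5) / sqrt (ln (real b + 1)) / sqrt u + d)"
      using u ab by (intro add_mono P_le) auto
    finally show "\<bar>depth_mix u a b f x - pois (max 0 c) f x\<bar>
      \<le> ((3 * C + 5) / sqrt (ln (real a + 1)) + (3 * C + 5) / sqrt (ln (real b + 1))) / sqrt u
        + \<bar>c - (2 * euler_mascheroni + ln (real a * u) + ln (real b * u))\<bar>"
      by (simp add: d_def add_divide_distrib)
  qed
qed

lemma borel_measurable_pois:
  assumes "Bseq f" "g \<in> borel_measurable M"
  shows "(\<lambda>y. pois (g y) f x) \<in> borel_measurable M"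
proof -
  have "continuous_on UNIV (\<lambda>lam. pois lam f x)"
    using pois_has_derivative [OF assms(1)] DERIV_isCont
    by (intro continuous_at_imp_continuous_on) blast
  hence "(\<lambda>lam. pois lam f x) \<in> borel_measurable borel" by (rule borel_measurable_continuous_onI)
  thus ?thesis using assms(2) by (rule measurable_compose_rev)
qed

text \<open>At \<open>u = exp (- y)\<close> one has
  \<open>ln (a * u) + ln (b * u) = ln a + ln b - 2 * y\<close>, so the parameter
  \<open>c - 2 * y\<close> leaves an error independent of \<open>y\<close>. The other factor,
  \<open>exp (y / 2)\<close>, has mean 2 and doubles the constant.\<close>

lemma depth_exp_pois_bound:
  obtains C where "C > 0"
    "\<And>f a b c x. bdd_lip1 f \<Longrightarrow> a \<ge> 1 \<Longrightarrow> b \<ge> 1 \<Longrightarrow>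
      \<bar>depth_exp a b f x - (\<integral>y. pois (max 0 (c - 2 * y)) f x \<partial>Exp1)\<bar>
      \<le> C / sqrt (ln (real a + 1)) + C / sqrt (ln (real b + 1))
        + \<bar>c - (2 * euler_mascheroni + ln (real a) + ln (real b))\<bar>"
proof -
  obtain C where C: "C > 0"
    "\<And>f u a b c x. bdd_lip1 f \<Longrightarrow> 0 < u \<Longrightarrow> u \<le> 1 \<Longrightarrow> a \<ge> 1 \<Longrightarrow> b \<ge> 1 \<Longrightarrow>
      \<bar>depth_mix u a b f x - pois (max 0 c) f x\<bar>
      \<le> (C / sqrt (ln (real a + 1)) + C / sqrt (ln (real b + 1))) / sqrt u
        + \<bar>c - (2 * euler_mascheroni + ln (real a * u) + ln (real b * u))\<bar>"
    by (rule depth_mix_pois_bound) blast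
  interpret E: prob_space Exp1 by (rule prob_space_Exp1)
  show ?thesis
  proof
    show "2 * C > 0" using C(1) by simp
    fix f :: "nat \<Rightarrow> real" and a b x :: nat and c :: real
    assume f: "bdd_lip1 f" and ab: "a \<ge> 1" "b \<ge> 1"
    define K where "K = C / sqrt (ln (real a + 1)) + C / sqrt (ln (real b + 1))"
    define d where "d = \<bar>c - (2 * euler_mascheroni + ln (real a) + ln (real b))\<bar>"
    have Bf: "Bseq f" using f by (simp add: bdd_lip1_def)
    obtain B where B: "B > 0" "\<And>k. \<bar>f k\<bar> \<le> B" by (rule Bseq_abs_bound [OF Bf]) blast
    have i2: "integrable Exp1 (\<lambda>y. pois (max 0 (c - 2 * y)) f x)"
      by (rule integrable_Exp1_bounded [of _ B])
         (auto intro!: borel_measurable_pois Bf pois_abs_le B)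
    have i1: "integrable Exp1 (\<lambda>y. depth_mix (exp (- y)) a b f x)"
      by (rule integrable_depth_mix [OF Bf])
    have pt: "\<bar>depth_mix (exp (- y)) a b f x - pois (max 0 (c - 2 * y)) f x\<bar> \<le> K * exp (y / 2) + d"
      if "0 \<le> y" for y
    proof -
      have "sqrt (exp (- y)) = exp (- (y / 2))"
        by (rule real_sqrt_unique) (simp_all add: power2_eq_square flip: exp_add)
      moreover have "exp (y / 2) = 1 / exp (- (y / 2))" by (simp add: eq_divide_eq flip: exp_add)
      ultimately have e: "exp (y / 2) = 1 / sqrt (exp (- y))" by (simp only:)
      have m: "\<bar>depth_mix (exp (- y)) a b f x - pois (max 0 (c - 2 * y)) f x\<bar>
        \<le> K / sqrt (exp (- y))
          + \<bar>c - 2 * y - (2 * euler_mascheroni + ln (real a * exp (- y)) + ln (real b * exp (- y)))\<bar>"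
        unfolding K_def using that by (intro C(2) f ab) auto
      have c: "c - 2 * y - (2 * euler_mascheroni + ln (real a * exp (- y)) + ln (real b * exp (- y)))
        = c - (2 * euler_mascheroni + ln (real a) + ln (real b))"
        using ab by (simp add: ln_mult)
      show ?thesis using m unfolding c d_def [symmetric] e by simp
    qed
    have "depth_exp a b f x - (\<integral>y. pois (max 0 (c - 2 * y)) f x \<partial>Exp1)
        = (\<integral>y. depth_mix (exp (- y)) a b f x - pois (max 0 (c - 2 * y)) f x \<partial>Exp1)"
      unfolding depth_exp_def by (rule Bochner_Integration.integral_diff [OF i1 i2, symmetric])
    also have "\<bar>\<dots>\<bar> \<le> (\<integral>y. \<bar>depth_mix (exp (- y)) a b f x - pois (max 0 (c - 2 * y)) f x\<bar> \<partial>Exp1)"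
      by (rule integral_abs_bound)
    also have "\<dots> \<le> (\<integral>y. K * exp (y / 2) + d \<partial>Exp1)"
      using Exp1_exp_half(1) i1 i2 AE_Exp1_nonneg
      by (intro integral_mono_AE) (auto elim!: eventually_mono simp: pt)
    also have "\<dots> = K * 2 + d"
      using Exp1_exp_half E.prob_space by (subst Bochner_Integration.integral_add) auto
    finally show "\<bar>depth_exp a b f x - (\<integral>y. pois (max 0 (c - 2 * y)) f x \<partial>Exp1)\<bar>
      \<le> 2 * C / sqrt (ln (real a + 1)) + 2 * C / sqrt (ln (real b + 1))
        + \<bar>c - (2 * euler_mascheroni + ln (real a) + ln (real b))\<bar>"
      by (simp add: K_def d_def algebra_simps)
  qed
qed

section \<open>From test functions to the Wasserstein distance\<close>

lemma bst_depth_dist_expectation: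
  assumes "1 \<le> l" "l \<le> n" "Bseq f"
  shows "measure_pmf.expectation (bst_depth_dist n l) f = depth_exp (l - 1) (n - l) f 0"
proof -
  have "{y \<in> {1..n}. y < l} = {1..<l}" "{y \<in> {1..n}. l < y} = {l<..n}" using assms by auto
  thus ?thesis
    using expectation_node_depth [of "{1..n}" l f 0] assms by (simp add: bst_depth_dist_def)
qed

lemma finite_set_bst_depth_dist: "finite (set_pmf (bst_depth_dist n l))"
  by (simp add: bst_depth_dist_def)

lemma bst_depth_dist_sums:
  "(\<lambda>k. f k * pmf (bst_depth_dist n l) k) sums measure_pmf.expectation (bst_depth_dist n l) f"
proof -
  let ?p = "bst_depth_dist n l"
  have "(\<lambda>k. f k * pmf ?p k) sums (\<Sum>k\<in>set_pmf ?p. f k * pmf ?p k)"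
    by (rule sums_finite) (auto simp: finite_set_bst_depth_dist set_pmf_iff)
  also have "(\<Sum>k\<in>set_pmf ?p. f k * pmf ?p k) = measure_pmf.expectation ?p f"
    by (subst integral_measure_pmf_real [of "set_pmf ?p"]) (auto simp: finite_set_bst_depth_dist)
  finally show ?thesis .
qed

lemma po_weight_le_one:
  assumes "0 \<le> lam"
  shows "po_weight lam k \<le> 1"
  using sum_le_suminf [of "po_weight lam" "{k}"] po_weight_sums [of lam] assms
  by (simp add: sums_iff)

text \<open>Sum and integral may be exchanged because the absolute partial sums have integrals below
  a bound of \<open>f\<close>.\<close>

lemma mixpo_sums:
  assumes "prob_space M" "sets M = sets borel" "AE x in M. 0 \<le> x" "Bseq f"
  shows "(\<lambda>k. f k * mixpo M k) sums (\<integral>x. pois x f 0 \<partial>M)"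
proof -
  interpret prob_space M by fact
  obtain B where B: "B > 0" "\<And>k. \<bar>f k\<bar> \<le> B" by (rule Bseq_abs_bound [OF assms(4)]) blast
  have meas: "(\<lambda>x. po_weight x k) \<in> borel_measurable M" for k
    unfolding measurable_cong_sets [OF assms(2) refl] po_weight_def by measurable
  have int: "integrable M (\<lambda>x. po_weight x k)" for k
    by (rule integrable_const_bound [of _ 1])
       (use assms(3) meas in \<open>auto elim!: eventually_mono intro!: po_weight_le_one\<close>)
  have mix: "mixpo M k = (\<integral>x. po_weight x k \<partial>M)" for k
    by (simp add: mixpo_def po_weight_def)
  have abs_sum: "summable (\<lambda>k. po_weight x k * \<bar>f k\<bar>)" if "0 \<le> x" for x
    using pois_summable [of "\<lambda>k. \<bar>f k\<bar>" x 0] B by (simp add: BseqI' [of _ B])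
  have "(\<lambda>k. \<integral>x. po_weight x k * f k \<partial>M) sums (\<integral>x. (\<Sum>k. po_weight x k * f k) \<partial>M)"
  proof (rule sums_integral)
    show "integrable M (\<lambda>x. po_weight x k * f k)" for k using int by simp
    show "AE x in M. summable (\<lambda>k. norm (po_weight x k * f k))"
      using assms(3) by eventually_elim (use abs_sum in \<open>auto simp: abs_mult\<close>)
    show "summable (\<lambda>k. \<integral>x. norm (po_weight x k * f k) \<partial>M)"
    proof (rule summableI_nonneg_bounded)
      show "0 \<le> (\<integral>x. norm (po_weight x k * f k) \<partial>M)" for k by simp
      fix n
      have "(\<Sum>k<n. \<integral>x. norm (po_weight x k * f k) \<partial>M) = (\<integral>x. (\<Sum>k<n. norm (po_weight x k * f k)) \<partial>M)"
        using int by (intro Bochner_Integration.integral_sum [symmetric]) auto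
      also have "\<dots> \<le> (\<integral>x. B \<partial>M)"
      proof (rule integral_mono_AE)
        show "AE x in M. (\<Sum>k<n. norm (po_weight x k * f k)) \<le> B"
          using assms(3)
        proof eventually_elim
          case (elim x)
          have "(\<Sum>k<n. norm (po_weight x k * f k)) \<le> (\<Sum>k. po_weight x k * \<bar>f k\<bar>)"
            using sum_le_suminf [OF abs_sum [OF elim], of "{..<n}"] elim by (simp add: abs_mult)
          also have "\<dots> \<le> B" using pois_abs_le [OF elim, of "\<lambda>k. \<bar>f k\<bar>" B 0] B by (simp add: pois_def)
          finally show ?case .
        qed
      qed (use int in auto)
      also have "\<dots> = B" by (simp add: prob_space)
      finally show "(\<Sum>k<n. \<integral>x. norm (po_weight x k * f k) \<partial>M) \<le> B" .
    qed
  qed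
  thus ?thesis by (simp add: mix pois_def mult.commute)
qed

text \<open>The signs of the differences of the tails are the increments of a function of Lipschitz constant \<open>1\<close>;
  finitely many of them give a bounded one.\<close>

lemma dW_nat_abs_le:
  assumes "summable p" "summable q"
    "\<And>f. bdd_lip1 f \<Longrightarrow> \<bar>(\<Sum>k. f k * p k) - (\<Sum>k. f k * q k)\<bar> \<le> C"
  shows "\<bar>dW_nat p q\<bar> \<le> C"
proof -
  define T where "T k = (\<Sum>j. p (k + j)) - (\<Sum>j. q (k + j))" for k
  have bound: "(\<Sum>k<K. \<bar>T k\<bar>) \<le> C" for K
  proof -
    define f where "f x = (\<Sum>k<K. if k \<le> x then sgn (T k) else 0)" for x
    have "\<bar>f x\<bar> \<le> real K" for x
    proof -
      have "\<bar>f x\<bar> \<le> (\<Sum>k<K. 1)"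
        unfolding f_def by (intro order_trans [OF sum_abs] sum_mono) (auto simp: sgn_if)
      thus ?thesis by simp
    qed
    moreover have "\<bar>f (Suc x) - f x\<bar> \<le> 1" for x
    proof -
      have "f (Suc x) - f x = (\<Sum>k<K. if k = Suc x then sgn (T k) else 0)"
        unfolding f_def by (subst sum_subtractf [symmetric], intro sum.cong) auto
      thus ?thesis by (simp add: sum.delta sgn_if)
    qed
    ultimately have f: "bdd_lip1 f" by (auto simp: bdd_lip1_def intro!: BseqI' [of f "real K"])
    \<comment> \<open>Summation by parts: pairing \<open>r\<close> with \<open>f\<close> adds up the
      tails of \<open>r\<close>, weighted by the signs.\<close>
    have tail: "(\<lambda>x. f x * r x) sums (\<Sum>k<K. sgn (T k) * (\<Sum>j. r (k + j)))" if r: "summable r" for r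
    proof -
      have "(\<lambda>x. if k \<le> x then r x else 0) sums (\<Sum>j. r (k + j))" for k
      proof -
        have "(\<lambda>j. r (j + k)) sums (\<Sum>j. r (j + k))"
          using r by (intro summable_sums) (simp add: summable_iff_shift)
        hence "(\<lambda>j. if k \<le> j + k then r (j + k) else 0) sums (\<Sum>j. r (k + j))"
          by (simp add: add.commute)
        thus ?thesis
          by (subst (asm) sums_iff_shift) simp
      qed
      hence "(\<lambda>x. \<Sum>k<K. sgn (T k) * (if k \<le> x then r x else 0)) sums (\<Sum>k<K. sgn (T k) * (\<Sum>j. r (k + j)))"
        by (intro sums_sum sums_mult)
      also have "(\<lambda>x. \<Sum>k<K. sgn (T k) * (if k \<le> x then r x else 0)) = (\<lambda>x. f x * r x)"
        unfolding f_def sum_distrib_right by (intro ext sum.cong) auto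
      finally show ?thesis .
    qed
    have "(\<Sum>k. f k * p k) - (\<Sum>k. f k * q k) = (\<Sum>k<K. sgn (T k) * T k)"
      using tail [OF assms(1)] tail [OF assms(2)]
      by (simp add: sums_iff T_def sum_subtractf algebra_simps)
    also have "\<dots> = (\<Sum>k<K. \<bar>T k\<bar>)" by (simp add: mult_sgn_abs abs_sgn mult.commute)
    finally show ?thesis using assms(3) [OF f] by linarith
  qed
  \<comment> \<open>Summability is needed for \<open>suminf\<close> in \<open>dW_nat\<close> to be a
    genuine sum; the common bound on the partial sums supplies it.\<close>
  have s: "summable (\<lambda>k. \<bar>T k\<bar>)"
    by (rule summableI_nonneg_bounded [of _ C]) (auto intro: bound)
  have "dW_nat p q = (\<Sum>k. \<bar>T k\<bar>)" by (simp add: dW_nat_def T_def)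
  moreover have "(\<Sum>k. \<bar>T k\<bar>) \<le> C" using s bound by (rule suminf_le_const)
  moreover have "(\<Sum>k. \<bar>T k\<bar>) \<ge> 0" using s by (intro suminf_nonneg) auto
  ultimately show ?thesis by simp
qed

lemma nu_properties:
  shows "prob_space (nu n t)" "sets (nu n t) = sets borel" "AE x in nu n t. 0 \<le> x"
proof -
  interpret prob_space Exp1 by (rule prob_space_Exp1)
  show "prob_space (nu n t)" unfolding nu_def by (rule prob_space_distr) measurable
  show "sets (nu n t) = sets borel" by (simp add: nu_def)
  show "AE x in nu n t. 0 \<le> x" unfolding nu_def by (subst AE_distr_iff) auto
qed

text \<open>With \<open>c\<close> the centring of \<open>nu\<close>, Euler's constant cancels, and
  the last term compares \<open>(l - 1) * (n - l)\<close> with \<open>n^2 * t * (1 - t)\<close> on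
  the logarithmic scale. The conditions on \<open>l\<close> provide a key on either side.\<close>

lemma dW_nat_bst_depth_bound:
  obtains C where "C > 0"
    "\<And>n l t. 2 \<le> l \<Longrightarrow> l < n \<Longrightarrow>
      \<bar>dW_nat (pmf (bst_depth_dist n l)) (mixpo (nu n t))\<bar>
      \<le> C / sqrt (ln (real (l - 1) + 1)) + C / sqrt (ln (real (n - l) + 1))
        + \<bar>2 * ln (real n) + ln (t * (1 - t)) - (ln (real (l - 1)) + ln (real (n - l)))\<bar>"
proof -
  obtain C where C: "C > 0"
    "\<And>f a b c x. bdd_lip1 f \<Longrightarrow> a \<ge> 1 \<Longrightarrow> b \<ge> 1 \<Longrightarrow>
      \<bar>depth_exp a b f x - (\<integral>y. pois (max 0 (c - 2 * y)) f x \<partial>Exp1)\<bar>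
      \<le> C / sqrt (ln (real a + 1)) + C / sqrt (ln (real b + 1))
        + \<bar>c - (2 * euler_mascheroni + ln (real a) + ln (real b))\<bar>"
    by (rule depth_exp_pois_bound) blast
  show ?thesis
  proof (rule that [OF C(1)])
    fix n l :: nat and t :: real assume l: "2 \<le> l" "l < n"
    define c where "c = 2 * ln (real n) + 2 * euler_mascheroni + ln (t * (1 - t))"
    note nu = nu_properties [of n t]
    have q: "(\<lambda>k. f k * mixpo (nu n t) k) sums (\<integral>y. pois (max 0 (c - 2 * y)) f 0 \<partial>Exp1)"
      if "Bseq f" for f
    proof -
      have "(\<integral>x. pois x f 0 \<partial>nu n t) = (\<integral>y. pois (max 0 (c - 2 * y)) f 0 \<partial>Exp1)"
        unfolding nu_def c_def using that by (subst integral_distr) (auto intro: borel_measurable_pois)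
      thus ?thesis using mixpo_sums [OF nu that] by simp
    qed
    show "\<bar>dW_nat (pmf (bst_depth_dist n l)) (mixpo (nu n t))\<bar>
      \<le> C / sqrt (ln (real (l - 1) + 1)) + C / sqrt (ln (real (n - l) + 1))
        + \<bar>2 * ln (real n) + ln (t * (1 - t)) - (ln (real (l - 1)) + ln (real (n - l)))\<bar>"
    proof (rule dW_nat_abs_le)
      show "summable (pmf (bst_depth_dist n l))"
        using bst_depth_dist_sums [of "\<lambda>_. 1" n l] by (simp add: sums_iff)
      have "Bseq (\<lambda>_::nat. 1::real)" by (rule BseqI' [of _ 1]) simp
      from q [OF this] show "summable (mixpo (nu n t))" by (simp add: sums_iff)
      fix f assume f: "bdd_lip1 f"
      hence Bf: "Bseq f" by (simp add: bdd_lip1_def)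
      have "(\<Sum>k. f k * pmf (bst_depth_dist n l) k) = depth_exp (l - 1) (n - l) f 0"
        using bst_depth_dist_sums [of f n l] bst_depth_dist_expectation [of l n f] Bf l
        by (simp add: sums_iff)
      moreover have "(\<Sum>k. f k * mixpo (nu n t) k) = (\<integral>y. pois (max 0 (c - 2 * y)) f 0 \<partial>Exp1)"
        using q [OF Bf] by (simp add: sums_iff)
      moreover have "c - (2 * euler_mascheroni + ln (real (l - 1)) + ln (real (n - l)))
          = 2 * ln (real n) + ln (t * (1 - t)) - (ln (real (l - 1)) + ln (real (n - l)))"
        by (simp add: c_def)
      moreover have "\<bar>depth_exp (l - 1) (n - l) f 0 - (\<integral>y. pois (max 0 (c - 2 * y)) f 0 \<partial>Exp1)\<bar>
        \<le> C / sqrt (ln (real (l - 1) + 1)) + C / sqrt (ln (real (n - l) + 1))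
          + \<bar>c - (2 * euler_mascheroni + ln (real (l - 1)) + ln (real (n - l)))\<bar>"
        by (rule C(2) [OF f]) (use l in auto)
      ultimately show "\<bar>(\<Sum>k. f k * pmf (bst_depth_dist n l) k) - (\<Sum>k. f k * mixpo (nu n t) k)\<bar>
        \<le> C / sqrt (ln (real (l - 1) + 1)) + C / sqrt (ln (real (n - l) + 1))
        + \<bar>2 * ln (real n) + ln (t * (1 - t)) - (ln (real (l - 1)) + ln (real (n - l)))\<bar>"
        by (simp only:)
    qed
  qed
qed

section \<open>Asymptotics when the rank is linear in \<open>n\<close>\<close>

abbreviation (input) rate :: "nat \<Rightarrow> real" where
  "rate \<equiv> \<lambda>n. 1 / sqrt (ln (real n))"

lemma rate_tendsto_zero: "rate \<longlonglongrightarrow> 0"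
  by real_asymp

lemma tendsto_of_bigo_rate:
  assumes "(\<lambda>n. s n - t) \<in> O(rate)"
  shows "s \<longlonglongrightarrow> (t :: real)"
proof -
  obtain c where "eventually (\<lambda>n. norm (s n - t) \<le> c * norm (rate n)) sequentially"
    using assms by (auto elim: landau_o.bigE)
  moreover have "(\<lambda>n. c * norm (rate n)) \<longlonglongrightarrow> c * norm (0::real)"
    by (intro tendsto_intros rate_tendsto_zero)
  ultimately have "(\<lambda>n. s n - t) \<longlonglongrightarrow> 0" by (auto intro: Lim_null_comparison)
  thus ?thesis by (simp add: LIM_zero_iff)
qed

lemma ln_ratio_bigo:
  fixes s g :: "nat \<Rightarrow> real"
  assumes "(\<lambda>n. s n - t) \<in> O(g)" "s \<longlonglongrightarrow> t" "0 < t"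
  shows "(\<lambda>n. ln (s n) - ln t) \<in> O(g)"
proof -
  have "eventually (\<lambda>n. s n > t / 2) sequentially"
    using assms by (intro order_tendstoD) auto
  hence "eventually (\<lambda>n. norm (ln (s n) - ln t) \<le> 4 / t * norm (s n - t)) sequentially"
  proof eventually_elim
    case (elim n)
    have "t / 2 = sqrt (t / 2 * (t / 2))"
      unfolding real_sqrt_abs2 using assms by simp
    also have "\<dots> \<le> sqrt (s n * t)" using elim assms by (intro real_sqrt_le_mono mult_mono) auto
    finally have "2 * \<bar>s n - t\<bar> / sqrt (s n * t) \<le> 2 * \<bar>s n - t\<bar> / (t / 2)"
      using assms elim by (intro divide_left_mono) auto
    moreover have "\<bar>ln (s n) - ln t\<bar> \<le> 2 * \<bar>s n - t\<bar> / sqrt (s n * t)"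
      using elim assms by (intro ln_diff_le_sqrt) auto
    ultimately show ?case by simp
  qed
  hence "(\<lambda>n. ln (s n) - ln t) \<in> O(\<lambda>n. s n - t)" by (rule bigoI)
  thus ?thesis using assms(1) by (rule landau_o.big_trans)
qed

text \<open>Eventually \<open>a n + 1 \<ge> sqrt n\<close>, so the logarithm loses at most a factor
  2; weakening this to 4 makes the square root produce the constant 2.\<close>

lemma rate_linear_bigo:
  fixes a :: "nat \<Rightarrow> nat"
  assumes "(\<lambda>n. real (a n) / real n) \<longlonglongrightarrow> t" "0 < t"
  shows "(\<lambda>n. 1 / sqrt (ln (real (a n) + 1))) \<in> O(rate)"
proof (rule bigoI)
  have "eventually (\<lambda>n. real (a n) / real n > t / 2) sequentially"
    using assms by (intro order_tendstoD) auto
  moreover have "eventually (\<lambda>n. t / 2 * real n \<ge> sqrt (real n)) sequentially"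
    using assms(2) by real_asymp
  ultimately show "eventually (\<lambda>n. norm (1 / sqrt (ln (real (a n) + 1))) \<le> 2 * norm (rate n)) sequentially"
    using eventually_gt_at_top [of 1]
  proof eventually_elim
    case (elim n)
    have "sqrt (real n) \<le> real (a n) + 1" using elim by (simp add: field_simps)
    hence "ln (sqrt (real n)) \<le> ln (real (a n) + 1)" using elim by (intro ln_mono) auto
    moreover have pos: "ln (real n) > 0" using elim by simp
    moreover have "ln (sqrt (real n)) = ln (real n) / 2" using elim by (simp add: ln_sqrt)
    ultimately have *: "ln (real n) / 4 \<le> ln (real (a n) + 1)" by linarith
    have q: "ln (real (a n) + 1) > 0" using pos * by linarith
    have "sqrt (ln (real n)) / 2 = sqrt (ln (real n) / 4)" by (simp add: real_sqrt_divide)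
    also have "\<dots> \<le> sqrt (ln (real (a n) + 1))" using * by simp
    finally have "1 / sqrt (ln (real (a n) + 1)) \<le> 1 / (sqrt (ln (real n)) / 2)"
      using pos q by (intro divide_left_mono mult_pos_pos) auto
    thus ?case using pos q by simp
  qed
qed

theorem theorem6:
  fixes l :: "nat \<Rightarrow> nat" and t :: real
  assumes "0 < t" and "t < 1"
    and "\<And>n. n \<ge> 1 \<Longrightarrow> 1 \<le> l n \<and> l n \<le> n"
    and "(\<lambda>n. real (l n) / real n - t) \<in> O(\<lambda>n. 1 / sqrt (ln (real n)))"
  shows "(\<lambda>n. dW_nat (pmf (bst_depth_dist n (l n))) (mixpo (nu n t)))
           \<in> O(\<lambda>n. 1 / sqrt (ln (real n)))"
proof -
  obtain C where C: "C > 0"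
    "\<And>n l t. 2 \<le> l \<Longrightarrow> l < n \<Longrightarrow>
      \<bar>dW_nat (pmf (bst_depth_dist n l)) (mixpo (nu n t))\<bar>
      \<le> C / sqrt (ln (real (l - 1) + 1)) + C / sqrt (ln (real (n - l) + 1))
        + \<bar>2 * ln (real n) + ln (t * (1 - t)) - (ln (real (l - 1)) + ln (real (n - l)))\<bar>"
    by (rule dW_nat_bst_depth_bound) blast
  \<comment> \<open>The numbers of smaller and of larger keys. Subtracting the key itself shifts the
    ratio by \<open>1 / n\<close>, which is within the rate.\<close>
  define a b where "a n = l n - 1" and "b n = n - l n" for n
  have "(\<lambda>n. 1 / real n) \<in> O(rate)" by real_asymp
  hence a0: "(\<lambda>n. (real (l n) / real n - t) - 1 / real n) \<in> O(rate)"
    by (rule sum_in_bigo(2) [OF assms(4)])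
  have ea: "eventually (\<lambda>n. (real (l n) / real n - t) - 1 / real n = real (a n) / real n - t) sequentially"
    using eventually_ge_at_top [of 1]
    by eventually_elim (use assms(3) in \<open>auto simp: a_def of_nat_diff diff_divide_distrib\<close>)
  have a_rate: "(\<lambda>n. real (a n) / real n - t) \<in> O(rate)"
    using landau_o.big.in_cong [OF ea] a0 by (rule iffD1)
  have b0: "(\<lambda>n. - (real (l n) / real n - t)) \<in> O(rate)"
    using assms(4) by (rule landau_o.big.uminus_in_iff [THEN iffD2])
  have eb: "eventually (\<lambda>n. - (real (l n) / real n - t) = real (b n) / real n - (1 - t)) sequentially"
    using eventually_ge_at_top [of 1]
    by eventually_elim (use assms(3) in \<open>auto simp: b_def of_nat_diff diff_divide_distrib\<close>)
  have b_rate: "(\<lambda>n. real (b n) / real n - (1 - t)) \<in> O(rate)"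
    using landau_o.big.in_cong [OF eb] b0 by (rule iffD1)
  have a_lim: "(\<lambda>n. real (a n) / real n) \<longlonglongrightarrow> t" and b_lim: "(\<lambda>n. real (b n) / real n) \<longlonglongrightarrow> 1 - t"
    using a_rate b_rate by (auto intro: tendsto_of_bigo_rate)
  have t: "0 < t" "0 < 1 - t" using assms by auto
  define R where "R n = C * (1 / sqrt (ln (real (a n) + 1))) + C * (1 / sqrt (ln (real (b n) + 1)))
    + (\<bar>ln (real (a n) / real n) - ln t\<bar> + \<bar>ln (real (b n) / real n) - ln (1 - t)\<bar>)" for n
  have R: "R \<in> O(rate)"
    unfolding R_def
    by (intro sum_in_bigo(1) landau_o.big.cmult_in_iff [THEN iffD2] rate_linear_bigo [OF a_lim] rate_linear_bigo [OF b_lim] t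
        landau_o.big.abs_in_iff [THEN iffD2] ln_ratio_bigo [OF a_rate a_lim] ln_ratio_bigo [OF b_rate b_lim])
      (use C(1) in auto)
  have "eventually (\<lambda>n. norm (dW_nat (pmf (bst_depth_dist n (l n))) (mixpo (nu n t))) \<le> norm (R n)) sequentially"
  proof -
    have "eventually (\<lambda>n. real (a n) / real n > 0) sequentially"
      "eventually (\<lambda>n. real (b n) / real n > 0) sequentially"
      using a_lim b_lim t by (auto intro: order_tendstoD)
    thus ?thesis
    proof eventually_elim
      case (elim n)
      hence pos: "a n > 0" "b n > 0" "n > 0" by (auto simp: zero_less_divide_iff)
      hence l: "2 \<le> l n" "l n < n" by (auto simp: a_def b_def)
      \<comment> \<open>The two copies of \<open>ln n\<close> are shared out between the two ratios,
        each of which is compared with its own limit.\<close>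
      have "2 * ln (real n) + ln (t * (1 - t)) - (ln (real (a n)) + ln (real (b n)))
          = - ((ln (real (a n) / real n) - ln t) + (ln (real (b n) / real n) - ln (1 - t)))"
        using pos t by (simp add: ln_div ln_mult)
      hence "\<bar>2 * ln (real n) + ln (t * (1 - t)) - (ln (real (a n)) + ln (real (b n)))\<bar>
          \<le> \<bar>ln (real (a n) / real n) - ln t\<bar> + \<bar>ln (real (b n) / real n) - ln (1 - t)\<bar>"
        by linarith
      with C(2) [OF l, of t, folded a_def b_def]
      have "\<bar>dW_nat (pmf (bst_depth_dist n (l n))) (mixpo (nu n t))\<bar> \<le> R n"
        by (simp add: R_def)
      thus ?case by simp
    qed
  qed
  hence "(\<lambda>n. dW_nat (pmf (bst_depth_dist n (l n))) (mixpo (nu n t))) \<in> O(R)"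
    by (rule landau_o.big_mono)
  thus ?thesis using R by (rule landau_o.big_trans)
qed

end
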